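(* Let $n\ge2$, let $\mathfrak q=\mathfrak q(n)$, and let $A$ be a finitely generated commutative associative unital $\mathbb C$-algebra. Then the local Weyl module $W_A^{\mathrm{loc}}(\psi)$ is finite dimensional for every $\psi\in\mathcal L(\mathfrak h\otimes A)$ such that $\lambda=\psi|_{\mathfrak h_{\bar0}}\in\Lambda^+$.
   Context: Everything is over $\mathbb C$; modules over superalgebras are $\mathbb Z_2$-graded, homomorphisms are even, and $\Pi$ is the parity change functor. The queer Lie superalgebra $\mathfrak q=\mathfrak q(n)$ consists of the block matrices $\begin{pmatrix}A&B\\ B&A\end{pmatrix}$, $A,B\in\mathfrak{gl}(n)$, inside $\mathfrak{gl}(n|n)$; the even part $\mathfrak q_{\bar0}\cong\mathfrak{gl}(n)$ is given by $B=0$ and the odd part by $A=0$. $\mathfrak h=\mathfrak h_{\bar0}\oplus\mathfrak h_{\bar1}$ is the subalgebra where $A,B$ are diagonal; $\mathfrak n^+$ (resp. $\mathfrak n^-$) is the subalgebra where $A,B$ are strictly upper (resp. lower) triangular; $\mathfrak b=\mathfrak b_+=\mathfrak h\oplus\mathfrak n^+$. Put $k_i=\mathrm{diag}(E_{i,i},E_{i,i})$, let $\{\epsilon_i\}$ be the basis of $\mathfrak h_{\bar0}^*$ dual to $\{k_i\}$, and for $i\in I=\{1,\dots,n-1\}$ let $h_i=k_i-k_{i+1}$ and $f_i=\mathrm{diag}(E_{i+1,i},E_{i+1,i})$. $\Lambda^+$ is the set of $\lambda=\sum\lambda_i\epsilon_i\in\mathfrak h_{\bar0}^*$ with $\lambda_i-\lambda_{i+1}\in\mathbb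 Z_{\ge0}$ for all $i\in I$ and such that $\lambda_i=\lambda_{i+1}$ implies $\lambda_i=\lambda_{i+1}=0$. $\mathfrak q\otimes A$ has bracket $[x\otimes a,y\otimes b]=[x,y]\otimes ab$ and contains $\mathfrak q=\mathfrak q\otimes\mathbb C$. $\mathcal L(\mathfrak h\otimes A)$ is the set of $\psi\in(\mathfrak h_{\bar0}\otimes A)^*$ such that $\psi(\mathfrak h_{\bar0}\otimes I)=0$ for some ideal $I\subseteq A$ of finite codimension. For $\psi\in\mathcal L(\mathfrak h\otimes A)$ there is (known fact) a unique, up to $\Pi$, simple finite-dimensional $\mathfrak h\otimes A$-module $H(\psi)$ with $xv=\psi(x)v$ for all $x\in\mathfrak h_{\bar0}\otimes A$, $v\in H(\psi)$; it is a $\mathfrak b\otimes A$-module with $\mathfrak n^+\otimes A$ acting by zero. For $\psi\in\mathcal L(\mathfrak h\otimes A)$ with $\lambda=\psi|_{\mathfrak h_{\bar0}}\in\Lambda^+$, the local Weyl module $W_A^{\mathrm{loc}}(\psi)$ (defined up to $\Pi$) is the $\mathfrak q\otimes A$-module generated by $H(\psi)$ with defining relations $(\mathfrak n^+\otimes A)w=0$, $xw=\psi(x)w$, $f_i^{\lambda(h_i)+1}w=0$ for all $w\in H(\psi)$, $x\in\mathfrak h_{\bar0}\otimes A$, $i\in I$; i.e. the quotient of $\mathbf U(\mathfrak q\otimes A)\otimes_{\mathbf U(\mathfrak b\otimes A)}H(\psi)$ by the submodule generated by all $f_i^{\lambda(h_i)+1}\otimes w$. *)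

theory Defs
  imports
    "HOL-Analysis.Finite_Cartesian_Product"
    "HOL-Library.Poly_Mapping"
    "HOL-Library.Z2"
    "HOL-Algebra.Module"
    "HOL-Algebra.AbelCoset"
begin

section \<open>Complex vector spaces and algebras\<close>

class scaleC =
  fixes scaleC :: "complex \<Rightarrow> 'a \<Rightarrow> 'a" (infixr \<open>*\<^sub>C\<close> 75)

class complex_vector = scaleC + ab_group_add +
  assumes scaleC_add_right: "c *\<^sub>C (x + y) = c *\<^sub>C x + c *\<^sub>C y"
    and scaleC_add_left: "(c + d) *\<^sub>C x = c *\<^sub>C x + d *\<^sub>C x"
    and scaleC_scaleC: "c *\<^sub>C (d *\<^sub>C x) = (c * d) *\<^sub>C x"
    and scaleC_one: "1 *\<^sub>C x = x"

class complex_algebra = complex_vector + ring +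
  assumes mult_scaleC_left: "(c *\<^sub>C x) * y = c *\<^sub>C (x * y)"
    and mult_scaleC_right: "x * (c *\<^sub>C y) = c *\<^sub>C (x * y)"

text \<open>The zero algebra is not excluded: \<open>0 \<noteq> 1\<close> is not assumed.\<close>

class complex_algebra_1 = complex_algebra + monoid_mult

class complex_comm_algebra_1 = complex_algebra + comm_ring + comm_monoid_mult
begin
subclass complex_algebra_1 ..
end

global_interpretation cvec: vector_space "scaleC :: complex \<Rightarrow> 'a \<Rightarrow> 'a::complex_vector"
  by unfold_locales (simp_all add: scaleC_add_right scaleC_add_left scaleC_scaleC scaleC_one)

abbreviation csubspace :: "'a::complex_vector set \<Rightarrow> bool"
  where "csubspace \<equiv> cvec.subspace"

abbreviation cspan :: "'a::complex_vector set \<Rightarrow> 'a set"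
  where "cspan \<equiv> cvec.span"

abbreviation clinear :: "('a::complex_vector \<Rightarrow> 'b::complex_vector) \<Rightarrow> bool"
  where "clinear \<equiv> Vector_Spaces.linear scaleC scaleC"

lemma clinear_iff:
  "clinear f \<longleftrightarrow> (\<forall>x y. f (x + y) = f x + f y) \<and> (\<forall>c x. f (c *\<^sub>C x) = c *\<^sub>C f x)"
  unfolding Vector_Spaces.linear_def module_hom_def module_hom_axioms_def
  by (auto simp: cvec.vector_space_axioms cvec.module_axioms)

instantiation complex :: complex_comm_algebra_1
begin
definition scaleC_complex :: "complex \<Rightarrow> complex \<Rightarrow> complex"
  where "scaleC_complex c x = c * x"
instance by standard (simp_all add: scaleC_complex_def algebra_simps)
end

instantiation vec :: (complex_vector, finite) complex_vector
begin
definition scaleC_vec :: "complex \<Rightarrow> 'a ^ 'b \<Rightarrow> 'a ^ 'b"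
  where "scaleC_vec c x = (\<chi> i. c *\<^sub>C (x $ i))"
instance
  by standard (simp_all add: scaleC_vec_def vec_eq_iff scaleC_add_right scaleC_add_left
      scaleC_scaleC scaleC_one)
end

instantiation poly_mapping :: (type, complex_vector) complex_vector
begin
lift_definition scaleC_poly_mapping :: "complex \<Rightarrow> ('a \<Rightarrow>\<^sub>0 'b) \<Rightarrow> 'a \<Rightarrow>\<^sub>0 'b"
  is "\<lambda>c f k. c *\<^sub>C f k"
  by (rule finite_subset) (auto simp: cvec.scale_zero_right)
instance
  by standard (transfer, simp add: fun_eq_iff scaleC_add_right scaleC_add_left
      scaleC_scaleC scaleC_one)+
end

lemma lookup_scaleC: "Poly_Mapping.lookup (c *\<^sub>C p) k = c *\<^sub>C Poly_Mapping.lookup p k"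
  by transfer simp

lemma poly_mapping_sum_single:
  fixes p :: "'a \<Rightarrow>\<^sub>0 'b::comm_monoid_add"
  shows "p = (\<Sum>k\<in>Poly_Mapping.keys p. Poly_Mapping.single k (Poly_Mapping.lookup p k))"
  by (rule poly_mapping_eqI)
    (auto simp: lookup_sum lookup_single when_def in_keys_iff)

lemma scaleC_single: "c *\<^sub>C Poly_Mapping.single k x = Poly_Mapping.single k (c *\<^sub>C x)"
  by (rule poly_mapping_eqI) (simp add: lookup_scaleC lookup_single when_def cvec.scale_zero_right)


instance poly_mapping :: (monoid_add, complex_algebra) complex_algebra
proof
  fix c :: complex and p q :: "'a \<Rightarrow>\<^sub>0 'b"
  let ?P = "Poly_Mapping.keys p" and ?Q = "Poly_Mapping.keys q"
  let ?p = "\<lambda>k. Poly_Mapping.single k (Poly_Mapping.lookup p k)"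
  let ?q = "\<lambda>k. Poly_Mapping.single k (Poly_Mapping.lookup q k)"
  have pq: "p = sum ?p ?P" "q = sum ?q ?Q" by (rule poly_mapping_sum_single)+
  have "(c *\<^sub>C sum ?p ?P) * sum ?q ?Q = c *\<^sub>C (sum ?p ?P * sum ?q ?Q)"
    by (simp add: sum_product cvec.scale_sum_right scaleC_single mult_single mult_scaleC_left)
  then show "(c *\<^sub>C p) * q = c *\<^sub>C (p * q)" using pq by simp
  have "sum ?p ?P * (c *\<^sub>C sum ?q ?Q) = c *\<^sub>C (sum ?p ?P * sum ?q ?Q)"
    by (simp add: sum_product cvec.scale_sum_right scaleC_single mult_single mult_scaleC_right)
  then show "p * (c *\<^sub>C q) = c *\<^sub>C (p * q)" using pq by simp
qed

definition finite_dimensional :: "'a::complex_vector itself \<Rightarrow> bool"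
  where "finite_dimensional _ \<longleftrightarrow> (\<exists>B::'a set. finite B \<and> cspan B = UNIV)"

inductive_set generated_algebra :: "'a::complex_algebra_1 set \<Rightarrow> 'a set" for S
  where
    gen: "x \<in> S \<Longrightarrow> x \<in> generated_algebra S"
  | one: "1 \<in> generated_algebra S"
  | add: "x \<in> generated_algebra S \<Longrightarrow> y \<in> generated_algebra S \<Longrightarrow> x + y \<in> generated_algebra S"
  | mult: "x \<in> generated_algebra S \<Longrightarrow> y \<in> generated_algebra S \<Longrightarrow> x * y \<in> generated_algebra S"
  | scale: "x \<in> generated_algebra S \<Longrightarrow> c *\<^sub>C x \<in> generated_algebra S"

definition finitely_generated_algebra :: "'a::complex_algebra_1 itself \<Rightarrow> bool"
  where "finitely_generated_algebra _ \<longleftrightarrow> (\<exists>S::'a set. finite S \<and> generated_algebra S = UNIV)"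

definition algebra_ideal :: "'a::complex_comm_algebra_1 set \<Rightarrow> bool"
  where "algebra_ideal I \<longleftrightarrow> csubspace I \<and> (\<forall>a. \<forall>x\<in>I. a * x \<in> I)"

text \<open>The classes of the elements of \<open>B\<close> span the quotient by \<open>I\<close> iff \<open>B \<union> I\<close> spans the
  whole space.\<close>

definition finite_codimension :: "'a::complex_vector set \<Rightarrow> bool"
  where "finite_codimension I \<longleftrightarrow> (\<exists>B. finite B \<and> cspan (B \<union> I) = UNIV)"


section \<open>Tensor products over the complex numbers\<close>

definition free_vec :: "'k \<Rightarrow> 'k \<Rightarrow>\<^sub>0 complex"
  where "free_vec k = Poly_Mapping.single k 1"

definition tensor_relations :: "('a::complex_vector \<times> 'b::complex_vector \<Rightarrow>\<^sub>0 complex) set"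
  where "tensor_relations =
      {free_vec (x + x', y) - (free_vec (x, y) + free_vec (x', y)) | x x' y. True}
    \<union> {free_vec (x, y + y') - (free_vec (x, y) + free_vec (x, y')) | x y y'. True}
    \<union> {free_vec (c *\<^sub>C x, y) - c *\<^sub>C free_vec (x, y) | c x y. True}
    \<union> {free_vec (x, c *\<^sub>C y) - c *\<^sub>C free_vec (x, y) | c x y. True}"

lemma equivp_diff_span: "equivp (\<lambda>p q. p - q \<in> cspan R)"
proof (intro equivpI reflpI sympI transpI)
  fix p q r
  show "p - p \<in> cspan R" by (simp add: cvec.span_zero)
  show "q - p \<in> cspan R" if "p - q \<in> cspan R"
    using cvec.span_neg[OF that] by simp
  show "p - r \<in> cspan R" if "p - q \<in> cspan R" "q - r \<in> cspan R"
    using cvec.span_add[OF that] by simp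
qed

lemma minus_cong_span:
  assumes "p - p' \<in> cspan R" "q - q' \<in> cspan R"
  shows "p - q - (p' - q') \<in> cspan R"
  using cvec.span_diff[OF assms] by (simp add: algebra_simps)

quotient_type (overloaded) ('a, 'b) tensor =
    "'a::complex_vector \<times> 'b::complex_vector \<Rightarrow>\<^sub>0 complex" / "\<lambda>p q. p - q \<in> cspan tensor_relations"
  by (rule equivp_diff_span)

instantiation tensor :: (complex_vector, complex_vector) complex_vector
begin

lift_definition zero_tensor :: "('a, 'b) tensor" is 0 .
lift_definition plus_tensor :: "('a, 'b) tensor \<Rightarrow> ('a, 'b) tensor \<Rightarrow> ('a, 'b) tensor" is "(+)"
  by (metis add_diff_add cvec.span_add)
lift_definition minus_tensor :: "('a, 'b) tensor \<Rightarrow> ('a, 'b) tensor \<Rightarrow> ('a, 'b) tensor" is "(-)"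
  by (rule minus_cong_span)
lift_definition uminus_tensor :: "('a, 'b) tensor \<Rightarrow> ('a, 'b) tensor" is uminus
  by (metis cvec.span_neg minus_diff_minus)
lift_definition scaleC_tensor :: "complex \<Rightarrow> ('a, 'b) tensor \<Rightarrow> ('a, 'b) tensor" is scaleC
  by (metis cvec.scale_right_diff_distrib cvec.span_scale)

instance
  by standard
    (transfer, simp add: cvec.span_zero algebra_simps scaleC_add_right scaleC_add_left scaleC_scaleC scaleC_one)+

end

lift_definition tens :: "'a::complex_vector \<Rightarrow> 'b::complex_vector \<Rightarrow> ('a, 'b) tensor" (infixl \<open>\<otimes>\<^sub>C\<close> 72)
  is "\<lambda>x y. free_vec (x, y)" .

lemma tens_add_left: "(x + x') \<otimes>\<^sub>C y = x \<otimes>\<^sub>C y + x' \<otimes>\<^sub>C y"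
  by transfer (rule cvec.span_base, unfold tensor_relations_def, blast)

lemma tens_add_right: "x \<otimes>\<^sub>C (y + y') = x \<otimes>\<^sub>C y + x \<otimes>\<^sub>C y'"
  by transfer (rule cvec.span_base, unfold tensor_relations_def, blast)

lemma tens_scaleC_left: "(c *\<^sub>C x) \<otimes>\<^sub>C y = c *\<^sub>C (x \<otimes>\<^sub>C y)"
  by transfer (rule cvec.span_base, unfold tensor_relations_def, blast)

lemma tens_scaleC_right: "x \<otimes>\<^sub>C (c *\<^sub>C y) = c *\<^sub>C (x \<otimes>\<^sub>C y)"
  by transfer (rule cvec.span_base, unfold tensor_relations_def, blast)

definition free_lift :: "('k \<Rightarrow> 'c::complex_vector) \<Rightarrow> ('k \<Rightarrow>\<^sub>0 complex) \<Rightarrow> 'c"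
  where "free_lift f p = (\<Sum>k\<in>Poly_Mapping.keys p. Poly_Mapping.lookup p k *\<^sub>C f k)"

lemma free_lift_superset:
  assumes "finite K" "Poly_Mapping.keys p \<subseteq> K"
  shows "free_lift f p = (\<Sum>k\<in>K. Poly_Mapping.lookup p k *\<^sub>C f k)"
  unfolding free_lift_def using assms
  by (intro sum.mono_neutral_left) (auto simp: in_keys_iff cvec.scale_zero_left)

lemma clinear_free_lift: "clinear (free_lift f)"
  unfolding clinear_iff
proof (intro conjI allI)
  fix p q :: "'a \<Rightarrow>\<^sub>0 complex" and c
  let ?K = "Poly_Mapping.keys p \<union> Poly_Mapping.keys q"
  have "Poly_Mapping.keys (p + q) \<subseteq> ?K" by (rule keys_add)
  then show "free_lift f (p + q) = free_lift f p + free_lift f q"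
    by (simp add: free_lift_superset[where K = ?K] lookup_add scaleC_add_left sum.distrib)
  have "Poly_Mapping.keys (c *\<^sub>C p) \<subseteq> Poly_Mapping.keys p"
    by (auto simp: in_keys_iff lookup_scaleC cvec.scale_zero_right)
  then show "free_lift f (c *\<^sub>C p) = c *\<^sub>C free_lift f p"
    by (simp add: free_lift_superset[where K = "Poly_Mapping.keys p"] lookup_scaleC
        cvec.scale_sum_right scaleC_scaleC scaleC_complex_def)
qed

lemma free_lift_free_vec: "free_lift f (free_vec k) = f k"
  by (simp add: free_lift_def free_vec_def scaleC_one)

definition cbilinear :: "('a::complex_vector \<Rightarrow> 'b::complex_vector \<Rightarrow> 'c::complex_vector) \<Rightarrow> bool"
  where "cbilinear f \<longleftrightarrow> (\<forall>y. clinear (\<lambda>x. f x y)) \<and> (\<forall>x. clinear (f x))"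

text \<open>The linear map on the tensor product induced by \<open>f\<close>; meaningful only for bilinear \<open>f\<close>, when it
  does not depend on the chosen representative.\<close>

definition tensor_lift :: "('a::complex_vector \<Rightarrow> 'b::complex_vector \<Rightarrow> 'c::complex_vector) \<Rightarrow> ('a, 'b) tensor \<Rightarrow> 'c"
  where "tensor_lift f t = free_lift (\<lambda>(x, y). f x y) (rep_tensor t)"

lemma tensor_lift_abs:
  assumes "cbilinear f"
  shows "tensor_lift f (abs_tensor p) = free_lift (\<lambda>(x, y). f x y) p"
proof -
  let ?F = "free_lift (\<lambda>(x, y). f x y)"
  interpret F: Vector_Spaces.linear scaleC scaleC ?F by (rule clinear_free_lift)
  have "?F r = 0" if "r \<in> tensor_relations" for r
    using that assms unfolding tensor_relations_def cbilinear_def clinear_iff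
    by (auto simp: F.diff F.add F.scale free_lift_free_vec)
  then have ker: "?F r = 0" if "r \<in> cspan tensor_relations" for r
    by (rule F.eq_0_on_span[OF _ that])
  have "rep_tensor (abs_tensor p) - p \<in> cspan tensor_relations"
    by (rule tensor.abs_eq_iff[THEN iffD1]) (rule Quotient3_abs_rep[OF Quotient3_tensor])
  from ker[OF this] show ?thesis by (simp add: tensor_lift_def F.diff)
qed

lemma tensor_lift_tens:
  assumes "cbilinear f"
  shows "tensor_lift f (x \<otimes>\<^sub>C y) = f x y"
  by (simp add: tens.abs_eq tensor_lift_abs[OF assms] free_lift_free_vec)

lemma clinear_tensor_lift:
  assumes "cbilinear f"
  shows "clinear (tensor_lift f)"
proof -
  interpret F: Vector_Spaces.linear scaleC scaleC "free_lift (\<lambda>(x, y). f x y)"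
    by (rule clinear_free_lift)
  have "tensor_lift f (s + t) = tensor_lift f s + tensor_lift f t" for s t
    by (induct s rule: tensor.abs_induct, induct t rule: tensor.abs_induct) (simp add: plus_tensor.abs_eq tensor_lift_abs[OF assms] F.add)
  moreover have "tensor_lift f (c *\<^sub>C t) = c *\<^sub>C tensor_lift f t" for c t
    by (induct t rule: tensor.abs_induct) (simp add: scaleC_tensor.abs_eq tensor_lift_abs[OF assms] F.scale)
  ultimately show ?thesis by (simp add: clinear_iff)
qed

lemma tensor_induct [case_names tens add]:
  assumes tens: "\<And>x y. P (x \<otimes>\<^sub>C y)"
    and add: "\<And>s t. P s \<Longrightarrow> P t \<Longrightarrow> P (s + t)"
  shows "P t"
proof -
  have sum: "P (abs_tensor (\<Sum>k\<in>K. c k *\<^sub>C free_vec k))" if "finite K"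
    for K and c :: "'a \<times> 'b \<Rightarrow> complex"
    using that
  proof induct
    case empty
    have "abs_tensor 0 = (0 :: 'a) \<otimes>\<^sub>C (0 :: 'b)"
      using tens_scaleC_left[of 0 "0 :: 'a" "0 :: 'b"] by (simp add: zero_tensor.abs_eq)
    then show ?case using tens[of 0 0] by simp
  next
    case (insert k K)
    have "abs_tensor (c k *\<^sub>C free_vec k) = (c k *\<^sub>C fst k) \<otimes>\<^sub>C snd k"
      unfolding tens_scaleC_left by (simp add: tens.abs_eq scaleC_tensor.abs_eq)
    with insert add[OF tens[of "c k *\<^sub>C fst k" "snd k"] insert(3)]
    show ?case by (simp add: plus_tensor.abs_eq[symmetric])
  qed
  have "p = (\<Sum>k\<in>Poly_Mapping.keys p. Poly_Mapping.lookup p k *\<^sub>C free_vec k)"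
    for p :: "'a \<times> 'b \<Rightarrow>\<^sub>0 complex"
    using poly_mapping_sum_single[of p]
    by (simp add: free_vec_def scaleC_single scaleC_complex_def)
  then have "P (abs_tensor p)" for p
    using sum[of "Poly_Mapping.keys p" "Poly_Mapping.lookup p"] by simp
  then show ?thesis by (induct t rule: tensor.abs_induct)
qed

text \<open>For subspaces this is the image of \<open>S \<otimes> T\<close>, which embeds since we work over a field.\<close>

definition tensor_span :: "'a::complex_vector set \<Rightarrow> 'b::complex_vector set \<Rightarrow> ('a, 'b) tensor set"
  where "tensor_span S T = cspan {x \<otimes>\<^sub>C y | x y. x \<in> S \<and> y \<in> T}"


section \<open>Lie superalgebras\<close>

text \<open>The group \<open>\<int>\<close> modulo \<open>2\<close> of parities is the type \<open>bit\<close>.\<close>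

class super_vector = complex_vector +
  fixes grade :: "bit \<Rightarrow> 'a set"
  assumes grade_zero: "0 \<in> grade i"
    and grade_add: "x \<in> grade i \<Longrightarrow> y \<in> grade i \<Longrightarrow> x + y \<in> grade i"
    and grade_scaleC: "x \<in> grade i \<Longrightarrow> c *\<^sub>C x \<in> grade i"
    and grade_disjoint: "x \<in> grade 0 \<Longrightarrow> x \<in> grade 1 \<Longrightarrow> x = 0"
    and grade_decomp: "\<exists>y\<in>grade 0. \<exists>z\<in>grade 1. x = y + z"

definition koszul :: "bit \<Rightarrow> bit \<Rightarrow> complex"
  where "koszul i j = (if i = 1 \<and> j = 1 then -1 else 1)"

class lie_superalgebra = super_vector +
  fixes lie_bracket :: "'a \<Rightarrow> 'a \<Rightarrow> 'a"
  assumes lie_bracket_add_left: "lie_bracket (x + y) z = lie_bracket x z + lie_bracket y z"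
    and lie_bracket_add_right: "lie_bracket x (y + z) = lie_bracket x y + lie_bracket x z"
    and lie_bracket_scaleC_left: "lie_bracket (c *\<^sub>C x) y = c *\<^sub>C lie_bracket x y"
    and lie_bracket_scaleC_right: "lie_bracket x (c *\<^sub>C y) = c *\<^sub>C lie_bracket x y"
    and lie_bracket_grade: "x \<in> grade i \<Longrightarrow> y \<in> grade j \<Longrightarrow> lie_bracket x y \<in> grade (i + j)"
    and lie_bracket_skew:
      "x \<in> grade i \<Longrightarrow> y \<in> grade j \<Longrightarrow> lie_bracket x y = - (koszul i j *\<^sub>C lie_bracket y x)"
    and lie_bracket_jacobi:
      "x \<in> grade i \<Longrightarrow> y \<in> grade j \<Longrightarrow> lie_bracket x (lie_bracket y z) =
        lie_bracket (lie_bracket x y) z + koszul i j *\<^sub>C lie_bracket y (lie_bracket x z)"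

lemma csubspace_grade: "csubspace (grade i)"
  by (simp add: cvec.subspace_def grade_zero grade_add grade_scaleC)

lemma grade_unique:
  assumes "y \<in> grade 0" "z \<in> grade 1" "y' \<in> grade 0" "z' \<in> grade 1" "y + z = y' + z'"
  shows "y = y'" "z = z'"
proof -
  have "y - y' = z' - z" using assms(5) by (simp add: algebra_simps)
  moreover have "y - y' \<in> grade 0" "z' - z \<in> grade 1"
    using assms cvec.subspace_diff[OF csubspace_grade] by blast+
  ultimately have "y - y' = 0" using grade_disjoint by metis
  then show "y = y'" "z = z'" using assms(5) by auto
qed

definition even_part :: "'a::super_vector \<Rightarrow> 'a"
  where "even_part x = (THE y. y \<in> grade 0 \<and> (\<exists>z\<in>grade 1. x = y + z))"

lemma even_part_add:
  assumes "y \<in> grade 0" "z \<in> grade 1"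
  shows "even_part (y + z) = y"
  unfolding even_part_def using assms grade_unique by (intro the_equality) blast+

lemma clinear_even_part: "clinear even_part"
  unfolding clinear_iff
proof (intro conjI allI)
  fix x x' :: 'a and c
  obtain y z where x: "y \<in> grade 0" "z \<in> grade 1" "x = y + z" using grade_decomp by blast
  obtain y' z' where x': "y' \<in> grade 0" "z' \<in> grade 1" "x' = y' + z'" using grade_decomp by blast
  have "x + x' = (y + y') + (z + z')" using x x' by simp
  then show "even_part (x + x') = even_part x + even_part x'"
    using x x' by (metis even_part_add grade_add)
  have "c *\<^sub>C x = c *\<^sub>C y + c *\<^sub>C z" using x by (simp add: scaleC_add_right)
  then show "even_part (c *\<^sub>C x) = c *\<^sub>C even_part x"
    using x by (metis even_part_add grade_scaleC)
qed

text \<open>In \<open>V \<otimes> W\<close> the second factor is purely even.\<close>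

instantiation tensor :: (super_vector, complex_vector) super_vector
begin

definition grade_tensor :: "bit \<Rightarrow> ('a, 'b) tensor set"
  where "grade_tensor i = tensor_span (grade i) UNIV"

instance
proof
  fix x y :: "('a, 'b) tensor" and i c
  show "0 \<in> (grade i :: ('a, 'b) tensor set)"
    by (simp add: grade_tensor_def tensor_span_def cvec.span_zero)
  show "x + y \<in> grade i" if "x \<in> grade i" "y \<in> grade i"
    using that by (simp add: grade_tensor_def tensor_span_def cvec.span_add)
  show "c *\<^sub>C x \<in> grade i" if "x \<in> grade i"
    using that by (simp add: grade_tensor_def tensor_span_def cvec.span_scale)
  let ?f = "\<lambda>(x::'a) (a::'b). even_part x \<otimes>\<^sub>C a"
  interpret E: Vector_Spaces.linear scaleC scaleC "even_part :: 'a \<Rightarrow> 'a"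
    by (rule clinear_even_part)
  have bil: "cbilinear ?f"
    by (simp add: cbilinear_def clinear_iff E.add E.scale tens_add_left tens_add_right
        tens_scaleC_left tens_scaleC_right)
  interpret F: Vector_Spaces.linear scaleC scaleC "tensor_lift ?f"
    by (rule clinear_tensor_lift[OF bil])
  interpret D: Vector_Spaces.linear scaleC scaleC "\<lambda>t. tensor_lift ?f t - t"
    by (simp add: clinear_iff F.add F.scale cvec.scale_right_diff_distrib)
  have ev: "even_part v = v" if "v \<in> grade 0" for v :: 'a
    using even_part_add[OF that grade_zero] by simp
  have od: "even_part v = 0" if "v \<in> grade 1" for v :: 'a
    using even_part_add[OF grade_zero that] by simp
  have z: "(0::'a) \<otimes>\<^sub>C (a::'b) = 0" for a
    using tens_scaleC_left[of 0 "0::'a" a] by (simp add: cvec.scale_zero_left)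
  show "x = 0" if x: "x \<in> grade 0" "x \<in> grade 1"
  proof -
    have "tensor_lift ?f x - x = 0"
      using x(1) unfolding grade_tensor_def tensor_span_def
      by (rule D.eq_0_on_span[rotated]) (auto simp: tensor_lift_tens[OF bil] ev)
    moreover have "tensor_lift ?f x = 0"
      using x(2) unfolding grade_tensor_def tensor_span_def
      by (rule F.eq_0_on_span[rotated]) (auto simp: tensor_lift_tens[OF bil] od z)
    ultimately show ?thesis by simp
  qed
  show "\<exists>y\<in>grade 0. \<exists>z\<in>grade 1. x = y + z"
  proof (induct x rule: tensor_induct)
    case (tens v a)
    obtain y z where v: "y \<in> grade 0" "z \<in> grade 1" "v = y + z" using grade_decomp by blast
    then have "y \<otimes>\<^sub>C a \<in> grade 0" "z \<otimes>\<^sub>C a \<in> grade 1"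
      by (auto simp: grade_tensor_def tensor_span_def intro!: cvec.span_base)
    moreover have "v \<otimes>\<^sub>C a = y \<otimes>\<^sub>C a + z \<otimes>\<^sub>C a" using v by (simp add: tens_add_left)
    ultimately show ?case by blast
  next
    case (add s t)
    then obtain y z y' z' where "y \<in> grade 0" "z \<in> grade 1" "s = y + z"
      "y' \<in> grade 0" "z' \<in> grade 1" "t = y' + z'" by blast
    then have "y + y' \<in> grade 0" "z + z' \<in> grade 1" "s + t = (y + y') + (z + z')"
      by (simp_all add: grade_tensor_def tensor_span_def cvec.span_add)
    then show ?case by blast
  qed
qed

end

lemma tensor_grade_induct [consumes 1, case_names tens zero add]:
  fixes t :: "('a::super_vector, 'b::complex_vector) tensor"
  assumes "t \<in> grade i"
    and tens: "\<And>x y. x \<in> grade i \<Longrightarrow> P (x \<otimes>\<^sub>C y)"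
    and zero: "P 0"
    and add: "\<And>s t. P s \<Longrightarrow> P t \<Longrightarrow> P (s + t)"
  shows "P t"
  using assms(1) unfolding grade_tensor_def tensor_span_def
proof (induct rule: cvec.span_induct_alt)
  case (step c x y)
  then obtain u a where "x = u \<otimes>\<^sub>C a" "u \<in> grade i" by auto
  then have "P (c *\<^sub>C x)"
    using tens[of "c *\<^sub>C u" a] by (simp add: grade_scaleC tens_scaleC_left)
  then show ?case using step add by blast
qed (rule zero)

lemma tensor_lift_add_fun:
  "tensor_lift (\<lambda>x y. f x y + g x y) t = tensor_lift f t + tensor_lift g t"
  by (simp add: tensor_lift_def free_lift_def split_beta scaleC_add_right sum.distrib)

lemma tensor_lift_scaleC_fun:
  "tensor_lift (\<lambda>x y. c *\<^sub>C f x y) t = c *\<^sub>C tensor_lift f t"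
  by (simp add: tensor_lift_def free_lift_def split_beta cvec.scale_sum_right scaleC_scaleC
      mult.commute)

instantiation tensor :: (lie_superalgebra, complex_comm_algebra_1) lie_superalgebra
begin

definition lie_bracket_tensor :: "('a, 'b) tensor \<Rightarrow> ('a, 'b) tensor \<Rightarrow> ('a, 'b) tensor"
  where "lie_bracket_tensor s t =
    tensor_lift (\<lambda>x a. tensor_lift (\<lambda>y b. lie_bracket x y \<otimes>\<^sub>C (a * b)) t) s"

lemma cbilinear_bracket_inner: "cbilinear (\<lambda>(y::'a) (b::'b). lie_bracket x y \<otimes>\<^sub>C (a * b))"
  by (simp add: cbilinear_def clinear_iff lie_bracket_add_right lie_bracket_scaleC_right
      tens_add_left tens_add_right tens_scaleC_left tens_scaleC_right distrib_left mult_scaleC_right)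

lemma cbilinear_bracket_outer:
  "cbilinear (\<lambda>(x::'a) (a::'b). tensor_lift (\<lambda>y b. lie_bracket x y \<otimes>\<^sub>C (a * b)) t)"
  by (simp add: cbilinear_def clinear_iff lie_bracket_add_left lie_bracket_scaleC_left
      tens_add_left tens_add_right tens_scaleC_left tens_scaleC_right distrib_right mult_scaleC_left
      tensor_lift_add_fun tensor_lift_scaleC_fun)

lemma lie_bracket_tens:
  fixes x y :: 'a and a b :: 'b
  shows "lie_bracket (x \<otimes>\<^sub>C a) (y \<otimes>\<^sub>C b) = lie_bracket x y \<otimes>\<^sub>C (a * b)"
  unfolding lie_bracket_tensor_def tensor_lift_tens[OF cbilinear_bracket_outer]
  by (rule tensor_lift_tens[OF cbilinear_bracket_inner])

lemma bracket_tensor_left: "clinear (\<lambda>s::('a, 'b) tensor. lie_bracket s t)"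
  unfolding lie_bracket_tensor_def by (rule clinear_tensor_lift[OF cbilinear_bracket_outer])

lemma bracket_tensor_right: "clinear (\<lambda>t::('a, 'b) tensor. lie_bracket s t)"
proof -
  have "clinear (tensor_lift (\<lambda>(y::'a) (b::'b). lie_bracket x y \<otimes>\<^sub>C (a * b)))" for x a
    by (rule clinear_tensor_lift[OF cbilinear_bracket_inner])
  then show ?thesis
    by (simp add: lie_bracket_tensor_def clinear_iff tensor_lift_add_fun tensor_lift_scaleC_fun)
qed

instance
proof
  fix x y z :: "('a, 'b) tensor" and c i j
  show add_l: "lie_bracket (x + y) z = lie_bracket x z + lie_bracket y z" for x y z :: "('a, 'b) tensor"
    using bracket_tensor_left[of z] by (simp add: clinear_iff)
  show add_r: "lie_bracket x (y + z) = lie_bracket x y + lie_bracket x z" for x y z :: "('a, 'b) tensor"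
    using bracket_tensor_right[of x] by (simp add: clinear_iff)
  show sc_l: "lie_bracket (c *\<^sub>C x) y = c *\<^sub>C lie_bracket x y" for x y :: "('a, 'b) tensor" and c
    using bracket_tensor_left[of y] by (simp add: clinear_iff)
  show sc_r: "lie_bracket x (c *\<^sub>C y) = c *\<^sub>C lie_bracket x y" for x y :: "('a, 'b) tensor" and c
    using bracket_tensor_right[of x] by (simp add: clinear_iff)
  note lin = add_l add_r sc_l sc_r scaleC_add_right scaleC_scaleC
  have zero: "lie_bracket 0 y = 0" "lie_bracket y 0 = 0" for y :: "('a, 'b) tensor"
    using sc_l[of 0 0 y] sc_r[of y 0 0] by (simp_all add: cvec.scale_zero_left)
  show "lie_bracket x y \<in> grade (i + j)" if "x \<in> grade i" "y \<in> grade j"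
    using that
  proof (induct x rule: tensor_grade_induct)
    case (tens u a)
    from tens(2) show ?case
    proof (induct y rule: tensor_grade_induct)
      case (tens v b)
      have "lie_bracket u v \<in> grade (i + j)" by (rule lie_bracket_grade) fact+
      then show ?case
        unfolding lie_bracket_tens grade_tensor_def tensor_span_def by (blast intro: cvec.span_base)
    qed (simp_all add: zero grade_zero add_r grade_add)
  qed (simp_all add: zero grade_zero add_l grade_add)
  show "lie_bracket x y = - (koszul i j *\<^sub>C lie_bracket y x)" if "x \<in> grade i" "y \<in> grade j"
    using that
  proof (induct x rule: tensor_grade_induct)
    case (tens u a)
    from tens(2) show ?case
    proof (induct y rule: tensor_grade_induct)
      case (tens v b)
      with \<open>u \<in> grade i\<close> have "lie_bracket u v = (- koszul i j) *\<^sub>C lie_bracket v u"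
        using lie_bracket_skew by (metis cvec.scale_minus_left)
      then have "lie_bracket u v \<otimes>\<^sub>C (a * b) = (- koszul i j) *\<^sub>C (lie_bracket v u \<otimes>\<^sub>C (b * a))"
        by (simp only: tens_scaleC_left mult.commute)
      then show ?case by (simp add: lie_bracket_tens cvec.scale_minus_left)
    qed (simp_all add: zero cvec.scale_zero_right lin)
  qed (simp_all add: zero cvec.scale_zero_right lin)
  show "lie_bracket x (lie_bracket y z) =
      lie_bracket (lie_bracket x y) z + koszul i j *\<^sub>C lie_bracket y (lie_bracket x z)"
    if "x \<in> grade i" "y \<in> grade j"
    using that
  proof (induct x rule: tensor_grade_induct)
    case (tens u a)
    from tens(2) show ?case
    proof (induct y rule: tensor_grade_induct)
      case (tens v b)
      show ?case
      proof (induct z rule: tensor_induct)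
        case (tens w d)
        show ?case
          using lie_bracket_jacobi[OF \<open>u \<in> grade i\<close> \<open>v \<in> grade j\<close>, of w]
          by (simp add: lie_bracket_tens tens_add_left tens_scaleC_left mult_ac)
      qed (simp add: lin)
    qed (simp_all add: zero cvec.scale_zero_right lin)
  qed (simp_all add: zero cvec.scale_zero_right lin)
qed

end


section \<open>Universal enveloping superalgebras\<close>

datatype 'l word = Word (letters: "'l list")

instantiation word :: (type) monoid_add
begin
definition zero_word :: "'a word" where "zero_word = Word []"
definition plus_word :: "'a word \<Rightarrow> 'a word \<Rightarrow> 'a word"
  where "plus_word v w = Word (letters v @ letters w)"
instance by standard (simp_all add: zero_word_def plus_word_def)
end

text \<open>With the convolution product, \<^typ>\<open>'l word \<Rightarrow>\<^sub>0 complex\<close> is the free unital algebra on the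
  set \<^typ>\<open>'l\<close>. The first two families of relations below make the embedding of the letters linear,
  which turns it into the tensor algebra.\<close>

definition letter :: "'l \<Rightarrow> 'l word \<Rightarrow>\<^sub>0 complex"
  where "letter x = free_vec (Word [x])"

definition uea_relations :: "('l::lie_superalgebra word \<Rightarrow>\<^sub>0 complex) set"
  where "uea_relations =
      {letter (x + y) - (letter x + letter y) | x y. True}
    \<union> {letter (c *\<^sub>C x) - c *\<^sub>C letter x | c x. True}
    \<union> {letter x * letter y - koszul i j *\<^sub>C (letter y * letter x) - letter (lie_bracket x y)
        | x y i j. x \<in> grade i \<and> y \<in> grade j}"

definition uea_ideal_generators :: "('l::lie_superalgebra word \<Rightarrow>\<^sub>0 complex) set"
  where "uea_ideal_generators = {p * r * q | p r q. r \<in> uea_relations}"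

lemma uea_ideal_mult:
  assumes "r \<in> cspan uea_ideal_generators"
  shows "p * r * q \<in> cspan uea_ideal_generators"
  using assms
proof (induct r rule: cvec.span_induct_alt)
  case base
  show ?case by (simp add: cvec.span_zero)
next
  case (step c x y)
  then obtain p' r q' where x: "x = p' * r * q'" "r \<in> uea_relations"
    by (auto simp: uea_ideal_generators_def)
  then have "p * x * q = (p * p') * r * (q' * q)" by (simp add: mult.assoc)
  then have "p * x * q \<in> uea_ideal_generators"
    using x(2) unfolding uea_ideal_generators_def by blast
  then have "c *\<^sub>C (p * x * q) + p * y * q \<in> cspan uea_ideal_generators"
    using step(2) by (blast intro: cvec.span_add cvec.span_scale cvec.span_base)
  then show ?case
    by (simp add: distrib_left distrib_right mult_scaleC_left mult_scaleC_right)
qed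

quotient_type (overloaded) 'l uea =
    "'l::lie_superalgebra word \<Rightarrow>\<^sub>0 complex" / "\<lambda>p q. p - q \<in> cspan uea_ideal_generators"
  by (rule equivp_diff_span)

instantiation uea :: (lie_superalgebra) complex_algebra_1
begin

lift_definition zero_uea :: "'a uea" is 0 .
lift_definition one_uea :: "'a uea" is 1 .
lift_definition plus_uea :: "'a uea \<Rightarrow> 'a uea \<Rightarrow> 'a uea" is "(+)"
  by (metis add_diff_add cvec.span_add)
lift_definition minus_uea :: "'a uea \<Rightarrow> 'a uea \<Rightarrow> 'a uea" is "(-)"
  by (rule minus_cong_span)
lift_definition uminus_uea :: "'a uea \<Rightarrow> 'a uea" is uminus
  by (metis cvec.span_neg minus_diff_minus)
lift_definition scaleC_uea :: "complex \<Rightarrow> 'a uea \<Rightarrow> 'a uea" is scaleC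
  by (metis cvec.scale_right_diff_distrib cvec.span_scale)
lift_definition times_uea :: "'a uea \<Rightarrow> 'a uea \<Rightarrow> 'a uea" is "(*)"
proof -
  fix p p' q q' :: "'a word \<Rightarrow>\<^sub>0 complex"
  assume "p - p' \<in> cspan uea_ideal_generators" "q - q' \<in> cspan uea_ideal_generators"
  then have "1 * (p - p') * q + p' * (q - q') * 1 \<in> cspan uea_ideal_generators"
    by (intro cvec.span_add uea_ideal_mult)
  then show "p * q - p' * q' \<in> cspan uea_ideal_generators"
    by (simp add: algebra_simps)
qed

instance
  by standard
    (transfer, simp add: cvec.span_zero algebra_simps scaleC_add_right scaleC_add_left
      scaleC_scaleC scaleC_one mult_scaleC_left mult_scaleC_right)+

end

text \<open>The class in \<open>U(L)\<close> of an element of the free algebra on \<open>L\<close>.\<close>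

definition uea_class :: "('l::lie_superalgebra word \<Rightarrow>\<^sub>0 complex) \<Rightarrow> 'l uea"
  where "uea_class = abs_uea"

definition uea_embed :: "'l::lie_superalgebra \<Rightarrow> 'l uea"
  where "uea_embed x = uea_class (letter x)"

definition uea_grade :: "bit \<Rightarrow> 'l::lie_superalgebra uea set"
  where "uea_grade i = cspan {uea_class (free_vec w) | w ps.
    list_all2 (\<lambda>x p. x \<in> grade p) (letters w) ps \<and> sum_list ps = i}"


section \<open>The queer Lie superalgebra\<close>

text \<open>The parity of a row or column index of a matrix in \<open>gl(n|n)\<close> is given by the summand it lies in.\<close>

definition gl_part :: "bit \<Rightarrow> complex^('n+'n)^('n+'n) \<Rightarrow> complex^('n::finite+'n)^('n+'n)"
  where "gl_part i M = (\<chi> r c. if (isl r = isl c) = (i = 0) then M $ r $ c else 0)"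

definition gl_bracket ::
    "complex^('n+'n)^('n+'n) \<Rightarrow> complex^('n+'n)^('n+'n) \<Rightarrow> complex^('n::finite+'n)^('n+'n)"
  where "gl_bracket X Y = (\<Sum>i\<in>{0, 1}. \<Sum>j\<in>{0, 1}.
    gl_part i X ** gl_part j Y - koszul i j *\<^sub>C (gl_part j Y ** gl_part i X))"

definition block :: "complex^'n^'n \<Rightarrow> complex^'n^'n \<Rightarrow> complex^('n::finite+'n)^('n+'n)"
  where "block A B = (\<chi> r c. case (r, c) of
      (Inl i, Inl j) \<Rightarrow> A $ i $ j | (Inl i, Inr j) \<Rightarrow> B $ i $ j
    | (Inr i, Inl j) \<Rightarrow> B $ i $ j | (Inr i, Inr j) \<Rightarrow> A $ i $ j)"

lemma block_nth:
  "block A B $ Inl i $ Inl j = A $ i $ j" "block A B $ Inl i $ Inr j = B $ i $ j"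
  "block A B $ Inr i $ Inl j = B $ i $ j" "block A B $ Inr i $ Inr j = A $ i $ j"
  by (simp_all add: block_def)

lemma gl_eq_iff: "M = N \<longleftrightarrow> (\<forall>i j. M $ Inl i $ Inl j = N $ Inl i $ Inl j \<and> M $ Inl i $ Inr j = N $ Inl i $ Inr j
    \<and> M $ Inr i $ Inl j = N $ Inr i $ Inl j \<and> M $ Inr i $ Inr j = N $ Inr i $ Inr j)"
  by (auto simp: vec_eq_iff split_sum_all)

lemma block_eq_iff: "block A B = block A' B' \<longleftrightarrow> A = A' \<and> B = B'"
  by (auto simp: gl_eq_iff block_nth vec_eq_iff)

lemma block_zero: "block 0 0 = 0"
  and block_add: "block A B + block A' B' = block (A + A') (B + B')"
  and block_diff: "block A B - block A' B' = block (A - A') (B - B')"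
  and block_uminus: "- block A B = block (- A) (- B)"
  and block_scaleC: "c *\<^sub>C block A B = block (c *\<^sub>C A) (c *\<^sub>C B)"
  by (simp_all add: gl_eq_iff block_nth scaleC_vec_def)

lemma sum_UNIV_sum:
  fixes f :: "'a::finite + 'b::finite \<Rightarrow> 'c::comm_monoid_add"
  shows "sum f UNIV = (\<Sum>i\<in>UNIV. f (Inl i)) + (\<Sum>j\<in>UNIV. f (Inr j))"
  by (simp add: UNIV_Plus_UNIV[symmetric] sum.Plus del: UNIV_Plus_UNIV)

lemma block_mult: "block A B ** block A' B' = block (A ** A' + B ** B') (A ** B' + B ** A')"
  by (simp add: gl_eq_iff block_nth matrix_matrix_mult_def sum_UNIV_sum add.commute)

lemma gl_part_block: "gl_part 0 (block A B) = block A 0" "gl_part 1 (block A B) = block 0 B"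
  by (simp_all add: gl_eq_iff block_nth gl_part_def)

lemma gl_bracket_block:
  "gl_bracket (block A B) (block A' B') =
    block ((A ** A' - A' ** A) + (B ** B' + B' ** B)) ((A ** B' - B' ** A) + (B ** A' - A' ** B))"
  by (simp add: gl_bracket_def gl_part_block block_mult block_add block_diff block_scaleC
      koszul_def scaleC_one cvec.scale_minus_left block_eq_iff algebra_simps)

typedef ('n::finite) queer = "{block A B | A B :: complex^'n^'n. True}"
  morphisms queer_matrix Abs_queer
  by blast

setup_lifting type_definition_queer

lift_definition queer_block :: "complex^'n^'n \<Rightarrow> complex^'n^'n \<Rightarrow> 'n::finite queer" is block
  by blast

lemma queer_cases [cases type: queer]:
  obtains A B where "x = queer_block A B"
  by transfer blast

lemma queer_block_eq_iff: "queer_block A B = queer_block A' B' \<longleftrightarrow> A = A' \<and> B = B'"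
  by transfer (rule block_eq_iff)

lemma matrix_simps:
  fixes A B C :: "complex^'n^'n"
  shows "(A + B) ** C = A ** C + B ** C" "A ** (B + C) = A ** B + A ** C"
    "(A - B) ** C = A ** C - B ** C" "A ** (B - C) = A ** B - A ** C"
    "(c *\<^sub>C A) ** B = c *\<^sub>C (A ** B)" "A ** (c *\<^sub>C B) = c *\<^sub>C (A ** B)"
    "A ** 0 = 0" "0 ** A = 0"
  by (simp_all add: vec_eq_iff matrix_matrix_mult_def scaleC_vec_def scaleC_complex_def
      algebra_simps sum.distrib sum_subtractf sum_distrib_left)

instantiation queer :: (finite) lie_superalgebra
begin

lift_definition zero_queer :: "'a queer" is 0
  using block_zero by metis
lift_definition plus_queer :: "'a queer \<Rightarrow> 'a queer \<Rightarrow> 'a queer" is "(+)"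
  using block_add by blast
lift_definition minus_queer :: "'a queer \<Rightarrow> 'a queer \<Rightarrow> 'a queer" is "(-)"
  using block_diff by blast
lift_definition uminus_queer :: "'a queer \<Rightarrow> 'a queer" is uminus
  using block_uminus by blast
lift_definition scaleC_queer :: "complex \<Rightarrow> 'a queer \<Rightarrow> 'a queer" is scaleC
  using block_scaleC by blast
lift_definition lie_bracket_queer :: "'a queer \<Rightarrow> 'a queer \<Rightarrow> 'a queer" is gl_bracket
  using gl_bracket_block by blast

definition grade_queer :: "bit \<Rightarrow> 'a queer set"
  where "grade_queer i = {x. gl_part i (queer_matrix x) = queer_matrix x}"

lemma queer_ops:
  "(0 :: 'a queer) = queer_block 0 0"
  "queer_block A B + queer_block A' B' = (queer_block (A + A') (B + B') :: 'a queer)"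
  "- queer_block A B = (queer_block (- A) (- B) :: 'a queer)"
  "c *\<^sub>C queer_block A B = (queer_block (c *\<^sub>C A) (c *\<^sub>C B) :: 'a queer)"
  "lie_bracket (queer_block A B) (queer_block A' B') = (queer_block
    ((A ** A' - A' ** A) + (B ** B' + B' ** B)) ((A ** B' - B' ** A) + (B ** A' - A' ** B)) :: 'a queer)"
  by (transfer, simp add: block_zero block_add block_uminus block_scaleC gl_bracket_block)+

lemma queer_block_grade:
  "(queer_block A B :: 'a queer) \<in> grade i \<longleftrightarrow> (if i = 0 then B = 0 else A = 0)"
  by (cases i) (auto simp: grade_queer_def queer_block.rep_eq gl_part_block block_eq_iff)

instance
proof
  fix x y z :: "'a queer" and c d :: complex and i j :: bit
  show "c *\<^sub>C (x + y) = c *\<^sub>C x + c *\<^sub>C y" by transfer (rule scaleC_add_right)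
  show "(c + d) *\<^sub>C x = c *\<^sub>C x + d *\<^sub>C x" by transfer (rule scaleC_add_left)
  show "c *\<^sub>C (d *\<^sub>C x) = (c * d) *\<^sub>C x" by transfer (rule scaleC_scaleC)
  show "1 *\<^sub>C x = x" by transfer (rule scaleC_one)
  show "x + y + z = x + (y + z)" by transfer (rule add.assoc)
  show "x + y = y + x" by transfer (rule add.commute)
  show "0 + x = x" by transfer simp
  show "- x + x = 0" by transfer simp
  show "x - y = x + - y" by transfer simp
  show "0 \<in> (grade i :: 'a queer set)" by (simp add: queer_ops queer_block_grade)
  show "x + y \<in> grade i" if "x \<in> grade i" "y \<in> grade i"
    using that by (cases x; cases y) (auto simp: queer_ops queer_block_grade split: if_splits)
  show "c *\<^sub>C x \<in> grade i" if "x \<in> grade i"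
    using that by (cases x) (auto simp: queer_ops queer_block_grade cvec.scale_zero_right split: if_splits)
  show "x = 0" if "x \<in> grade 0" "x \<in> grade 1"
    using that by (cases x) (auto simp: queer_ops queer_block_grade)
  show "\<exists>y\<in>grade 0. \<exists>z\<in>grade 1. x = y + z"
  proof (cases x)
    case (1 A B)
    have "queer_block A 0 \<in> grade 0" "queer_block 0 B \<in> grade 1"
      "x = queer_block A 0 + queer_block 0 B"
      by (simp_all add: 1 queer_ops queer_block_grade)
    then show ?thesis by blast
  qed
  show "lie_bracket (x + y) z = lie_bracket x z + lie_bracket y z"
    by (cases x; cases y; cases z) (simp add: queer_ops queer_block_eq_iff matrix_simps)
  show "lie_bracket x (y + z) = lie_bracket x y + lie_bracket x z"
    by (cases x; cases y; cases z) (simp add: queer_ops queer_block_eq_iff matrix_simps)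
  show "lie_bracket (c *\<^sub>C x) y = c *\<^sub>C lie_bracket x y"
    by (cases x; cases y) (simp add: queer_ops queer_block_eq_iff matrix_simps scaleC_add_right
        cvec.scale_right_diff_distrib)
  show "lie_bracket x (c *\<^sub>C y) = c *\<^sub>C lie_bracket x y"
    by (cases x; cases y) (simp add: queer_ops queer_block_eq_iff matrix_simps scaleC_add_right
        cvec.scale_right_diff_distrib)
  show "lie_bracket x y \<in> grade (i + j)" if "x \<in> grade i" "y \<in> grade j"
    using that by (cases i; cases j; cases x; cases y)
      (auto simp: queer_ops queer_block_grade matrix_simps)
  show "lie_bracket x y = - (koszul i j *\<^sub>C lie_bracket y x)" if "x \<in> grade i" "y \<in> grade j"
    using that by (cases i; cases j; cases x; cases y)
      (auto simp: queer_ops queer_block_grade matrix_simps queer_block_eq_iff koszul_def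
        scaleC_one cvec.scale_minus_left)
  show "lie_bracket x (lie_bracket y z) =
      lie_bracket (lie_bracket x y) z + koszul i j *\<^sub>C lie_bracket y (lie_bracket x z)"
    if "x \<in> grade i" "y \<in> grade j"
    using that by (cases i; cases j; cases x; cases y; cases z)
      (auto simp: queer_ops queer_block_grade matrix_simps queer_block_eq_iff koszul_def
        scaleC_one cvec.scale_minus_left matrix_mul_assoc)
qed

end


text \<open>The rows and columns are indexed by a finite linear order \<^typ>\<open>'n\<close> with \<open>n = CARD('n)\<close> elements,
  which plays the role of \<open>{1, \<dots>, n}\<close>.\<close>

definition diagonal :: "complex^'n^'n \<Rightarrow> bool"
  where "diagonal A \<longleftrightarrow> (\<forall>i j. i \<noteq> j \<longrightarrow> A $ i $ j = 0)"

definition strictly_upper :: "complex^'n::{finite, linorder}^'n::{finite, linorder} \<Rightarrow> bool"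
  where "strictly_upper A \<longleftrightarrow> (\<forall>i j. \<not> i < j \<longrightarrow> A $ i $ j = 0)"

definition cartan :: "'n::finite queer set"
  where "cartan = {queer_block A B | A B. diagonal A \<and> diagonal B}"

definition cartan_even :: "'n::finite queer set"
  where "cartan_even = cartan \<inter> grade 0"

definition n_plus :: "'n::{finite, linorder} queer set"
  where "n_plus = {queer_block A B | A B. strictly_upper A \<and> strictly_upper B}"

definition borel_subalgebra :: "'n::{finite, linorder} queer set"
  where "borel_subalgebra = {x + y | x y. x \<in> cartan \<and> y \<in> n_plus}"

definition matrix_unit :: "'n \<Rightarrow> 'n \<Rightarrow> complex^'n^'n"
  where "matrix_unit i j = (\<chi> r c. if r = i \<and> c = j then 1 else 0)"

definition index_set :: "'n::{finite, linorder} set"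
  where "index_set = {i. \<exists>j. i < j}"

definition next_index :: "'n::{finite, linorder} \<Rightarrow> 'n"
  where "next_index i = (LEAST j. i < j)"

definition k_elem :: "'n \<Rightarrow> 'n::finite queer"
  where "k_elem i = queer_block (matrix_unit i i) 0"

definition h_elem :: "'n \<Rightarrow> 'n::{finite, linorder} queer"
  where "h_elem i = k_elem i - k_elem (next_index i)"

definition f_elem :: "'n \<Rightarrow> 'n::{finite, linorder} queer"
  where "f_elem i = queer_block (matrix_unit (next_index i) i) 0"

text \<open>A weight \<open>\<lambda> = \<Sum>\<^sub>i \<lambda>\<^sub>i \<epsilon>\<^sub>i\<close> is a linear functional on \<^const>\<open>cartan_even\<close>, with coordinates
  \<open>\<lambda>\<^sub>i = \<lambda> (k_elem i)\<close>.  Functionals are represented by functions on the whole algebra whose values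
  outside of the subspace in question are irrelevant.\<close>

definition dominant_weights :: "('n::{finite, linorder} queer \<Rightarrow> complex) set"
  where "dominant_weights = {\<mu>. \<forall>i\<in>index_set.
    \<mu> (k_elem i) - \<mu> (k_elem (next_index i)) \<in> \<nat> \<and>
    (\<mu> (k_elem i) = \<mu> (k_elem (next_index i)) \<longrightarrow>
      \<mu> (k_elem i) = 0 \<and> \<mu> (k_elem (next_index i)) = 0)}"

definition linear_on :: "'a::complex_vector set \<Rightarrow> ('a \<Rightarrow> complex) \<Rightarrow> bool"
  where "linear_on S f \<longleftrightarrow> (\<forall>x\<in>S. \<forall>y\<in>S. f (x + y) = f x + f y) \<and> (\<forall>c. \<forall>x\<in>S. f (c *\<^sub>C x) = c * f x)"

text \<open>The set \<open>\<L>(\<hh> \<otimes> A)\<close>.\<close>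

definition loop_weights ::
    "(('n::finite queer, 'a::complex_comm_algebra_1) tensor \<Rightarrow> complex) set"
  where "loop_weights = {\<psi>. linear_on (tensor_span cartan_even UNIV) \<psi> \<and>
    (\<exists>I. algebra_ideal I \<and> finite_codimension I \<and> (\<forall>x\<in>tensor_span cartan_even I. \<psi> x = 0))}"


section \<open>Modules over subalgebras\<close>

text \<open>Module structures on a whole type: only the values of \<open>\<rho>\<close> on the graded subalgebra \<open>S\<close> matter.\<close>

definition supermodule ::
    "'l::lie_superalgebra set \<Rightarrow> ('l \<Rightarrow> 'v::super_vector \<Rightarrow> 'v) \<Rightarrow> bool"
  where "supermodule S \<rho> \<longleftrightarrow>
    (\<forall>x\<in>S. clinear (\<rho> x)) \<and>
    (\<forall>x\<in>S. \<forall>y\<in>S. \<forall>v. \<rho> (x + y) v = \<rho> x v + \<rho> y v) \<and>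
    (\<forall>c. \<forall>x\<in>S. \<forall>v. \<rho> (c *\<^sub>C x) v = c *\<^sub>C \<rho> x v) \<and>
    (\<forall>i j. \<forall>x\<in>S \<inter> grade i. \<forall>v\<in>grade j. \<rho> x v \<in> grade (i + j)) \<and>
    (\<forall>i j. \<forall>x\<in>S \<inter> grade i. \<forall>y\<in>S \<inter> grade j. \<forall>v.
      \<rho> (lie_bracket x y) v = \<rho> x (\<rho> y v) - koszul i j *\<^sub>C \<rho> y (\<rho> x v))"

definition subsupermodule ::
    "'l::lie_superalgebra set \<Rightarrow> ('l \<Rightarrow> 'v::super_vector \<Rightarrow> 'v) \<Rightarrow> 'v set \<Rightarrow> bool"
  where "subsupermodule S \<rho> N \<longleftrightarrow> csubspace N \<and>
    (\<forall>v\<in>N. \<exists>y\<in>N \<inter> grade 0. \<exists>z\<in>N \<inter> grade 1. v = y + z) \<and>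
    (\<forall>x\<in>S. \<forall>v\<in>N. \<rho> x v \<in> N)"

definition simple_supermodule ::
    "'l::lie_superalgebra set \<Rightarrow> ('l \<Rightarrow> 'v::super_vector \<Rightarrow> 'v) \<Rightarrow> bool"
  where "simple_supermodule S \<rho> \<longleftrightarrow> supermodule S \<rho> \<and> (\<exists>v::'v. v \<noteq> 0) \<and>
    (\<forall>N. subsupermodule S \<rho> N \<longrightarrow> N = {0} \<or> N = UNIV)"

text \<open>The type \<^typ>\<open>'h\<close> with the action \<open>\<rho>\<close> is the \<open>\<bb> \<otimes> A\<close>-module \<open>H(\<psi>)\<close>, for one of the two choices of
  parity.\<close>

definition is_H_module ::
    "(('n::{finite, linorder} queer, 'a::complex_comm_algebra_1) tensor \<Rightarrow> complex) \<Rightarrow>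
     (('n queer, 'a) tensor \<Rightarrow> 'h::super_vector \<Rightarrow> 'h) \<Rightarrow> bool"
  where "is_H_module \<psi> \<rho> \<longleftrightarrow>
    supermodule (tensor_span borel_subalgebra UNIV) \<rho> \<and>
    (\<forall>x\<in>tensor_span n_plus UNIV. \<forall>v. \<rho> x v = 0) \<and>
    simple_supermodule (tensor_span cartan UNIV) \<rho> \<and>
    finite_dimensional TYPE('h) \<and>
    (\<forall>x\<in>tensor_span cartan_even UNIV. \<forall>v. \<rho> x v = \<psi> x *\<^sub>C v)"


section \<open>Quotient modules and generated submodules\<close>

definition complex_ring :: "complex ring"
  where "complex_ring = \<lparr>carrier = UNIV, mult = (*), one = 1, zero = 0, add = (+)\<rparr>"

text \<open>Modules over a Lie superalgebra with explicit carrier, as modules over \<^const>\<open>complex_ring\<close> with an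
  action and a grading.  The fields \<^const>\<open>mult\<close> and \<^const>\<open>one\<close> are a mere artefact of the
  library's record of modules.\<close>

record ('l, 'v) lie_module = "(complex, 'v) module" +
  act :: "'l \<Rightarrow> 'v \<Rightarrow> 'v"
  part :: "bit \<Rightarrow> 'v set"

definition graded_submodule :: "('l, 'v) lie_module \<Rightarrow> 'v set \<Rightarrow> bool"
  where "graded_submodule M N \<longleftrightarrow> submodule N complex_ring M \<and>
    (\<forall>v\<in>N. \<exists>y\<in>N \<inter> part M 0. \<exists>z\<in>N \<inter> part M 1. v = y \<oplus>\<^bsub>M\<^esub> z) \<and>
    (\<forall>x. \<forall>v\<in>N. act M x v \<in> N)"

definition generated_submodule :: "('l, 'v) lie_module \<Rightarrow> 'v set \<Rightarrow> 'v set"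
  where "generated_submodule M S = \<Inter>{N. graded_submodule M N \<and> S \<subseteq> N}"

definition quotient_module :: "('l, 'v) lie_module \<Rightarrow> 'v set \<Rightarrow> ('l, 'v set) lie_module"
  where "quotient_module M N = \<lparr>
    carrier = a_rcosets\<^bsub>M\<^esub> N, mult = undefined, one = undefined, zero = N,
    add = (\<lambda>X Y. X <+>\<^bsub>M\<^esub> Y),
    smult = (\<lambda>c X. \<Union>v\<in>X. N +>\<^bsub>M\<^esub> (c \<odot>\<^bsub>M\<^esub> v)),
    act = (\<lambda>x X. \<Union>v\<in>X. N +>\<^bsub>M\<^esub> act M x v),
    part = (\<lambda>i. (\<lambda>v. N +>\<^bsub>M\<^esub> v) ` part M i)\<rparr>"

definition finite_dimensional_module :: "('l, 'v) lie_module \<Rightarrow> bool"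
  where "finite_dimensional_module M \<longleftrightarrow> (\<exists>B. finite B \<and> B \<subseteq> carrier M \<and>
    (\<forall>v\<in>carrier M. \<exists>c. v = (\<Oplus>\<^bsub>M\<^esub>b\<in>B. c b \<odot>\<^bsub>M\<^esub> b)))"


section \<open>Induced modules and local Weyl modules\<close>

text \<open>The \<open>L\<close>-module \<open>U(L) \<otimes> V\<close>, the tensor product being over the complex numbers.\<close>

definition uea_tensor :: "('l::lie_superalgebra, ('l uea, 'v::super_vector) tensor) lie_module"
  where "uea_tensor = \<lparr>
    carrier = UNIV, mult = undefined, one = undefined, zero = 0, add = (+), smult = (*\<^sub>C),
    act = (\<lambda>x. tensor_lift (\<lambda>u v. (uea_embed x * u) \<otimes>\<^sub>C v)),
    part = (\<lambda>i. cspan {u \<otimes>\<^sub>C v | u v j k. u \<in> uea_grade j \<and> v \<in> grade k \<and> j + k = i})\<rparr>"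

text \<open>The action on an \<open>S\<close>-module of the free algebra on \<open>S\<close>, and hence of its quotient \<open>U(S)\<close>.\<close>

definition free_action :: "('l \<Rightarrow> 'v \<Rightarrow> 'v) \<Rightarrow> ('l word \<Rightarrow>\<^sub>0 complex) \<Rightarrow> 'v \<Rightarrow> 'v::complex_vector"
  where "free_action \<rho> p v = free_lift (\<lambda>w. foldr \<rho> (letters w) v) p"

text \<open>The elements of \<open>U(S)\<close> are represented by elements \<open>p\<close> of the free algebra on \<open>S\<close>.\<close>

definition balancing_relations ::
    "'l::lie_superalgebra set \<Rightarrow> ('l \<Rightarrow> 'v::super_vector \<Rightarrow> 'v) \<Rightarrow> ('l uea, 'v) tensor set"
  where "balancing_relations S \<rho> = cspan
    {(u * uea_class p) \<otimes>\<^sub>C v - u \<otimes>\<^sub>C free_action \<rho> p v | u p v.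
      \<forall>w\<in>Poly_Mapping.keys p. set (letters w) \<subseteq> S}"

definition induced_module ::
    "'l::lie_superalgebra set \<Rightarrow> ('l \<Rightarrow> 'v::super_vector \<Rightarrow> 'v) \<Rightarrow>
     ('l, ('l uea, 'v) tensor set) lie_module"
  where "induced_module S \<rho> = quotient_module uea_tensor (balancing_relations S \<rho>)"

text \<open>The element \<open>u \<otimes> v\<close> of \<open>U(L) \<otimes>\<^bsub>U(S)\<^esub> V\<close>.\<close>

definition induced_tens ::
    "'l::lie_superalgebra set \<Rightarrow> ('l \<Rightarrow> 'v::super_vector \<Rightarrow> 'v) \<Rightarrow> 'l uea \<Rightarrow> 'v \<Rightarrow> ('l uea, 'v) tensor set"
  where "induced_tens S \<rho> u v =
    balancing_relations S \<rho> +>\<^bsub>uea_tensor :: ('l, ('l uea, 'v) tensor) lie_module\<^esub> (u \<otimes>\<^sub>C v)"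

text \<open>The local Weyl module, where \<open>H(\<psi>)\<close> is given by the action \<open>\<rho>\<close>.  The exponent
  \<open>\<lambda>(h\<^sub>i) + 1\<close> is \<open>m + 1\<close> for the natural number \<open>m\<close> equal to \<open>\<lambda>(h\<^sub>i)\<close>.\<close>

definition local_weyl_module ::
    "(('n::{finite, linorder} queer, 'a::complex_comm_algebra_1) tensor \<Rightarrow> complex) \<Rightarrow>
     (('n queer, 'a) tensor \<Rightarrow> 'h::super_vector \<Rightarrow> 'h) \<Rightarrow>
     (('n queer, 'a) tensor, (('n queer, 'a) tensor uea, 'h) tensor set set) lie_module"
  where "local_weyl_module \<psi> \<rho> =
    (let S = tensor_span borel_subalgebra UNIV; M = induced_module S \<rho>
     in quotient_module M (generated_submodule M
      {induced_tens S \<rho> (uea_embed (f_elem i \<otimes>\<^sub>C 1) ^ (m + 1)) v | i m v.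
        i \<in> index_set \<and> of_nat m = \<psi> (h_elem i \<otimes>\<^sub>C 1)}))"

end

(* Let W be the local Weyl module and H its generating space. Over A, each e_i, f_i, h_i spans a copy
   of sl2 \<otimes> A. Applying e_i \<otimes> a_1, ..., e_i \<otimes> a_m with all a_k in the ideal I on which the weight
   vanishes to f_i^(m+1) w = 0 yields a nonzero multiple of (f_i \<otimes> a_1 ... a_m) w, because (h_i \<otimes> I) w = 0.
   Taking brackets, n^- \<otimes> J kills H, and then all of W, for some ideal J of finite codimension, so
   W is spanned by words on H in finitely many letters from n^- \<otimes> A. Each letter acts nilpotently
   on H: for even simple roots, apply h_i \<otimes> b repeatedly to f_i^N w = 0; for other even roots use a
   Heisenberg triple; odd root vectors square to zero. Letters supercommute up to shorter words, so
   in a long word some letter occurs often enough to be moved to the right and kill H. No weight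
   theory of integrable modules is needed. *)

theory Submission
  imports Defs "HOL-Library.Multiset"
begin

section \<open>Words in operators that commute up to shorter words\<close>

text \<open>Two sources of infinity have to be removed: the coefficients run through all of A, and
  words have unbounded length. For the first, finite generation of A enters only through the fact
  that an ideal of finite codimension is then finitely generated as an ideal. Hence products of such
  ideals again have finite codimension, and so does the ideal of coefficients that a given negative
  root contributes to the annihilator of H; J is the intersection of these ideals over all roots.
  For the second, nilpotency of a letter is known on H only, not on the whole module, which is why
  the copies of a frequent letter must be brought next to H. The elements of the local Weyl module
  are cosets of cosets in an explicit carrier. All computations are therefore done for operators on
  a plain vector space that satisfy the bracket relations of q \<otimes> A; a linear projection
  along the kernel of the double quotient supplies such operators. An induction on words in lowering
  operators takes the place of the triangular decomposition of the enveloping algebra.\<close>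

lemma clinearI:
  assumes "\<And>x y. f (x + y) = f x + f y" "\<And>c x. f (c *\<^sub>C x) = c *\<^sub>C f x"
  shows "clinear f"
  using assms by (simp add: clinear_iff)

lemma clinear_funpow: "clinear (f :: 'v::complex_vector \<Rightarrow> 'v) \<Longrightarrow> clinear (f ^^ k)"
  by (induction k) (auto simp: clinear_iff)

lemma clinear_in_subspace:
  assumes "clinear f" "csubspace S" "\<And>x. x \<in> A \<Longrightarrow> f x \<in> S" "y \<in> cspan A"
  shows "f y \<in> S"
  using assms(4)
proof (induction y rule: cvec.span_induct_alt)
  case base
  then show ?case
    using assms(1,2) module_hom.zero cvec.subspace_0 unfolding Vector_Spaces.linear_def by metis
next
  case (step c x y)
  then show ?case
    using assms(1-3) by (simp add: clinear_iff cvec.subspace_add cvec.subspace_scale)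
qed

text \<open>The swap relation is demanded only on \<open>U\<close>: in the application the bracket
  of two letters is a combination of the finitely many letters only where n^- \<otimes> J acts by
  zero. The factor \<open>\<epsilon>\<close> is arbitrary, since words only have to be controlled
  modulo shorter ones.\<close>

locale word_operators =
  fixes T :: "'y \<Rightarrow> 'v::complex_vector \<Rightarrow> 'v" and Y :: "'y set" and U H :: "'v set" and N :: nat
  assumes T_linear: "y \<in> Y \<Longrightarrow> clinear (T y)"
    and finite_Y: "finite Y"
    and finite_H: "finite H"
    and H_subset: "H \<subseteq> U"
    and T_U: "y \<in> Y \<Longrightarrow> u \<in> U \<Longrightarrow> T y u \<in> U"
    and T_swap: "y \<in> Y \<Longrightarrow> y' \<in> Y \<Longrightarrow>
      u \<in> U \<Longrightarrow> \<exists>\<epsilon>. T y (T y' u) - \<epsilon> *\<^sub>C T y' (T y u) \<in> cspan ((\<lambda>z. T z u) ` Y)"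
    and T_nilpotent: "y \<in> Y \<Longrightarrow> h \<in> H \<Longrightarrow> (T y ^^ N) h = 0"
begin

definition word_span :: "nat \<Rightarrow> 'v set"
  where "word_span k = cspan {foldr T w h | w h. set w \<subseteq> Y \<and> length w \<le> k \<and> h \<in> H}"

lemma word_in_word_span: "set w \<subseteq> Y \<Longrightarrow> length w \<le> k \<Longrightarrow> h \<in> H \<Longrightarrow> foldr T w h \<in> word_span k"
  unfolding word_span_def by (rule cvec.span_base) blast

lemma clinear_foldr: "set w \<subseteq> Y \<Longrightarrow> clinear (foldr T w)"
  by (induction w) (use T_linear in \<open>auto simp: clinear_iff\<close>)

lemma foldr_in_U: "set w \<subseteq> Y \<Longrightarrow> h \<in> H \<Longrightarrow> foldr T w h \<in> U"
  by (induction w) (use H_subset T_U in auto)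

text \<open>In the correction terms a single letter replaces the pair, so their length is at most
  \<open>k\<close>. The relation may be used inside a word because the suffix applied to
  \<open>h\<close> stays in \<open>U\<close>.\<close>

lemma swap_adjacent:
  assumes "set (w1 @ y # y' # w2) \<subseteq> Y" "h \<in> H" "length (w1 @ y # y' # w2) \<le> Suc k"
    and "foldr T (w1 @ y' # y # w2) h \<in> word_span k"
  shows "foldr T (w1 @ y # y' # w2) h \<in> word_span k"
proof -
  define u where "u = foldr T w2 h"
  have u: "u \<in> U" using assms foldr_in_U by (simp add: u_def)
  interpret L: Vector_Spaces.linear scaleC scaleC "foldr T w1"
    using assms by (intro clinear_foldr) auto
  have "y \<in> Y" "y' \<in> Y" using assms(1) by auto
  then obtain \<epsilon> where "T y (T y' u) - \<epsilon> *\<^sub>C T y' (T y u) \<in> cspan ((\<lambda>z. T z u) ` Y)"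
    using T_swap u by blast
  then have "foldr T w1 (T y (T y' u) - \<epsilon> *\<^sub>C T y' (T y u)) \<in> word_span k"
  proof (rule clinear_in_subspace[OF L.linear_axioms, rotated 2])
    fix x assume "x \<in> (\<lambda>z. T z u) ` Y"
    then obtain z where z: "z \<in> Y" "x = T z u" by blast
    have "foldr T (w1 @ z # w2) h \<in> word_span k"
      using assms z by (intro word_in_word_span) auto
    then show "foldr T w1 x \<in> word_span k" by (simp add: z u_def)
  qed (simp add: word_span_def)
  moreover have "\<epsilon> *\<^sub>C foldr T w1 (T y' (T y u)) \<in> word_span k"
    using assms(4) by (simp add: u_def word_span_def cvec.span_scale)
  ultimately have "foldr T w1 (T y (T y' u) - \<epsilon> *\<^sub>C T y' (T y u))
      + \<epsilon> *\<^sub>C foldr T w1 (T y' (T y u)) \<in> word_span k"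
    unfolding word_span_def by (rule cvec.span_add)
  then show ?thesis by (simp add: u_def L.diff L.scale)
qed

lemma move_to_front:
  assumes "set (pre @ us @ y # vs) \<subseteq> Y" "h \<in> H" "length (pre @ us @ y # vs) \<le> Suc k"
    and "foldr T (pre @ y # us @ vs) h \<in> word_span k"
  shows "foldr T (pre @ us @ y # vs) h \<in> word_span k"
  using assms
proof (induction us arbitrary: pre)
  case (Cons a us)
  have "foldr T ((pre @ [a]) @ us @ y # vs) h \<in> word_span k"
  proof (rule Cons.IH)
    show "foldr T ((pre @ [a]) @ y # us @ vs) h \<in> word_span k"
      using swap_adjacent[of pre a y "us @ vs" h k] Cons.prems by auto
  qed (use Cons.prems in auto)
  then show ?case by simp
qed auto

text \<open>Insertion sort: \<open>pre\<close> holds the letters already in their final place and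
  grows by one letter per step.\<close>

lemma permute_word:
  assumes "mset w' = mset w" "set (pre @ w) \<subseteq> Y" "h \<in> H" "length (pre @ w) \<le> Suc k"
    and "foldr T (pre @ w') h \<in> word_span k"
  shows "foldr T (pre @ w) h \<in> word_span k"
  using assms
proof (induction w' arbitrary: pre w)
  case (Cons y w')
  have "y \<in> set w" using Cons.prems(1) by (metis list.set_intros(1) set_mset_mset)
  then obtain us vs where w: "w = us @ y # vs" by (meson split_list)
  have "foldr T ((pre @ [y]) @ (us @ vs)) h \<in> word_span k"
    by (rule Cons.IH) (use Cons.prems w in auto)
  then show ?case
    using move_to_front[of pre us y vs h k] Cons.prems w by auto
qed auto

lemma long_word:
  assumes w: "set w \<subseteq> Y" "h \<in> H" "length w = Suc k" and k: "card Y * N \<le> k"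
  shows "foldr T w h \<in> word_span k"
proof -
  have "\<exists>y\<in>Y. N \<le> count_list w y"
  proof (rule ccontr)
    assume "\<not> ?thesis"
    then have "sum (count_list w) Y \<le> (\<Sum>y\<in>Y. N)" by (intro sum_mono) (auto simp: not_le)
    then show False using sum_count_set[OF w(1) finite_Y] w k by simp
  qed
  then obtain y where y: "y \<in> Y" "N \<le> count_list w y" by blast
  \<comment> \<open>\<open>w\<close> is compared with the word that has all \<open>?c\<close> copies
    of \<open>y\<close> at its right end, where the innermost \<open>N\<close> of them already kill
    \<open>h\<close>.\<close>
  let ?c = "count_list w y" and ?w = "filter (\<lambda>x. x \<noteq> y) w"
  interpret L: Vector_Spaces.linear scaleC scaleC "foldr T ?w"
    using w by (intro clinear_foldr) auto
  interpret P: Vector_Spaces.linear scaleC scaleC "T y ^^ (?c - N)"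
    using y T_linear by (intro clinear_funpow) auto
  have "(T y ^^ ?c) h = (T y ^^ (?c - N)) ((T y ^^ N) h)"
    using y(2) by (metis comp_apply funpow_add le_add_diff_inverse2)
  then have "(T y ^^ ?c) h = 0" using T_nilpotent y w by (simp add: P.zero)
  then have 0: "foldr T (?w @ replicate ?c y) h = 0" by (simp add: foldr_replicate L.zero)
  have "mset (replicate ?c y) = filter_mset (\<lambda>x. x = y) (mset w)"
    by (induction w) auto
  then have "mset (?w @ replicate ?c y) = mset w"
    by (simp add: mset_filter flip: multiset_partition[of "mset w" "\<lambda>x. x = y"]) 
  then show ?thesis
    using permute_word[of "?w @ replicate ?c y" w "[]" h k] w 0
    by (simp add: word_span_def cvec.span_zero)
qed

lemma word_span_bounded: "word_span k \<subseteq> word_span (card Y * N)"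
proof (induction k)
  case 0
  show ?case unfolding word_span_def by (rule cvec.span_mono) fastforce
next
  case (Suc k)
  show ?case
  proof (cases "Suc k \<le> card Y * N")
    case True
    then show ?thesis unfolding word_span_def by (intro cvec.span_mono) fastforce
  next
    case False
    have "word_span (Suc k) \<subseteq> word_span k"
      unfolding word_span_def[of "Suc k"]
    proof (rule cvec.span_minimal)
      show "csubspace (word_span k)" by (simp add: word_span_def)
      show "{foldr T w h | w h. set w \<subseteq> Y \<and> length w \<le> Suc k \<and> h \<in> H} \<subseteq> word_span k"
        using long_word[of _ _ k] word_in_word_span False
        by (auto simp: le_Suc_eq)
    qed
    then show ?thesis using Suc by blast
  qed
qed

lemma finite_span_words:
  "\<exists>B. finite B \<and> (\<forall>w h. set w \<subseteq> Y \<longrightarrow> h \<in> H \<longrightarrow> foldr T w h \<in> cspan B)"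
proof (intro exI conjI allI impI)
  let ?B = "(\<lambda>(w, h). foldr T w h) ` ({w. set w \<subseteq> Y \<and> length w \<le> card Y * N} \<times> H)"
  show "finite ?B" using finite_lists_length_le[OF finite_Y] finite_H by auto
  have "{foldr T w h | w h. set w \<subseteq> Y \<and> length w \<le> card Y * N \<and> h \<in> H} = ?B" by auto
  then show "foldr T w h \<in> cspan ?B" if "set w \<subseteq> Y" "h \<in> H" for w h
    using word_in_word_span[OF that(1) order_refl that(2)] word_span_bounded[of "length w"]
    by (auto simp: word_span_def)
qed

end


section \<open>Ideals of finite codimension\<close>

lemma clinear_mult_left: "clinear ((*) (a :: 'a::complex_algebra))"
  by (simp add: clinear_iff distrib_left mult_scaleC_right)

lemma algebra_ideal_UNIV: "algebra_ideal UNIV"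
  by (simp add: algebra_ideal_def)

lemma cspan_Un_ideal_decomp:
  assumes "cspan (B \<union> I) = UNIV" "csubspace I"
  obtains b x where "b \<in> cspan B" "x \<in> I" "a = b + x"
proof -
  have "a \<in> cspan (B \<union> I)" using assms by simp
  moreover have "cspan I = I" using assms by simp
  ultimately show ?thesis unfolding cvec.span_Un using that by auto
qed

text \<open>An analogue of Schreier generators. Fix a finite \<open>B\<close> containing 1 that
  spans \<open>A\<close> modulo \<open>I\<close>, and let \<open>c a\<close> be the error in
  \<open>I\<close> of approximating \<open>a\<close> by the span of \<open>B\<close>. The generators
  are a basis \<open>D\<close> of the part of \<open>I\<close> inside the span of \<open>B\<close>,
  together with the errors of all products of an algebra generator and an element of
  \<open>B\<close>. With \<open>I1\<close> the ideal they generate, the span of \<open>B\<close>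
  plus \<open>I1\<close> contains 1 and is stable under the algebra generators, so it is all of
  \<open>A\<close>. An element of \<open>I\<close> then differs from one of \<open>I1\<close> by an
  element of the span of \<open>D\<close>.\<close>

lemma finite_codimension_ideal_finitely_generated:
  fixes I :: "'a::complex_comm_algebra_1 set"
  assumes "finitely_generated_algebra TYPE('a)" and I: "algebra_ideal I" "finite_codimension I"
  obtains G where "finite G" "G \<subseteq> I" "I \<subseteq> cspan {a * g | a g. g \<in> G}"
proof -
  obtain S :: "'a set" where S: "finite S" "generated_algebra S = UNIV"
    using assms(1) unfolding finitely_generated_algebra_def by blast
  obtain B0 where B0: "finite B0" "cspan (B0 \<union> I) = UNIV"
    using I(2) unfolding finite_codimension_def by blast
  define B where "B = insert 1 B0"
  have "cspan (B0 \<union> I) \<subseteq> cspan (B \<union> I)" unfolding B_def by (rule cvec.span_mono) auto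
  then have B: "finite B" "cspan (B \<union> I) = UNIV" "1 \<in> B" using B0 by (auto simp: B_def)
  have sI: "csubspace I" using I by (simp add: algebra_ideal_def)
  have "\<exists>c. c \<in> I \<and> a - c \<in> cspan B" for a
    by (rule cspan_Un_ideal_decomp[OF B(2) sI, of a]) (metis add_diff_cancel_right')
  then obtain c where c: "\<And>a. c a \<in> I" "\<And>a. a - c a \<in> cspan B" by metis
  obtain D where D: "D \<subseteq> cspan B \<inter> I" "cvec.independent D" "cspan B \<inter> I \<subseteq> cspan D"
    by (metis cvec.basis_exists)
  have "finite D" using cvec.independent_span_bound[OF B(1) D(2)] D(1) by blast
  define G where "G = D \<union> (\<lambda>(x, b). c (x * b)) ` (S \<times> B)"
  define I1 where "I1 = cspan {a * g | a g. g \<in> G}"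
  have G: "finite G" using \<open>finite D\<close> S B by (simp add: G_def)
  have GI: "G \<subseteq> I" using D c by (auto simp: G_def)
  have G_I1: "g \<in> G \<Longrightarrow> a * g \<in> I1" for a g unfolding I1_def by (rule cvec.span_base) auto
  have I1_I: "I1 \<subseteq> I"
    unfolding I1_def using GI I by (intro cvec.span_minimal) (auto simp: algebra_ideal_def)
  have I1_mult: "a * x \<in> I1" if "x \<in> I1" for a x
    using that unfolding I1_def
  proof (rule clinear_in_subspace[rotated 3, OF _ clinear_mult_left])
    fix x assume "x \<in> {a * g | a g. g \<in> G}"
    then obtain b g where "x = b * g" "g \<in> G" by blast
    then show "a * x \<in> cspan {a * g | a g. g \<in> G}"
      using G_I1[of g "a * b"] by (simp add: I1_def mult.assoc)
  qed simp
  define C where "C = cspan (B \<union> I1)"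
  have C: "csubspace C" by (simp add: C_def)
  have S_C: "x * y \<in> C" if "x \<in> S" "y \<in> C" for x y
    using that(2) unfolding C_def
  proof (rule clinear_in_subspace[rotated 3, OF _ clinear_mult_left])
    fix y assume y: "y \<in> B \<union> I1"
    show "x * y \<in> cspan (B \<union> I1)"
    proof (cases "y \<in> B")
      case True
      then have "1 * c (x * y) \<in> I1" using that by (intro G_I1) (auto simp: G_def)
      then have "c (x * y) \<in> cspan (B \<union> I1)" by (simp add: cvec.span_base)
      moreover have "x * y - c (x * y) \<in> cspan (B \<union> I1)"
        using c(2) cvec.span_mono[of B "B \<union> I1"] by blast
      ultimately show ?thesis by (metis cvec.span_add diff_add_cancel)
    next
      case False
      then show ?thesis using y I1_mult by (auto intro: cvec.span_base)
    qed
  qed simp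
  have "a \<in> generated_algebra S" for a using S by simp
  then have mult_C: "\<forall>y\<in>C. a * y \<in> C" for a
  proof (induction rule: generated_algebra.induct)
    case (gen x)
    then show ?case using S_C by blast
  next
    case (add x y)
    then show ?case using C by (auto simp: distrib_right intro: cvec.subspace_add)
  next
    case (mult x y)
    then show ?case by (auto simp: mult.assoc)
  next
    case (scale x c)
    then show ?case using C by (auto simp: mult_scaleC_left intro: cvec.subspace_scale)
  qed auto
  have C_UNIV: "a \<in> C" for a
  proof -
    have "1 \<in> C" unfolding C_def using B(3) by (intro cvec.span_base) auto
    then show ?thesis using mult_C[of a] by force
  qed
  have "I \<subseteq> I1"
  proof
    fix x assume x: "x \<in> I"
    have s1: "csubspace I1" by (simp add: I1_def)
    obtain b y where b: "b \<in> cspan B" "y \<in> I1" "x = b + y"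
      by (rule cspan_Un_ideal_decomp[OF _ s1, of B x]) (use C_UNIV in \<open>auto simp: C_def\<close>)
    then have "b \<in> I" using x I1_I sI by (metis add_diff_cancel_right' cvec.subspace_diff subsetD)
    then have "b \<in> cspan D" using D by (simp add: b subset_iff)
    moreover have "cspan D \<subseteq> I1"
    proof (rule cvec.span_minimal[OF _ s1])
      show "D \<subseteq> I1" using G_I1[of _ 1] by (auto simp: G_def)
    qed
    ultimately show "x \<in> I1" using b s1 by (auto intro: cvec.subspace_add)
  qed
  then show thesis using that G GI by (simp add: I1_def)
qed

text \<open>I / IJ is a finitely generated module over the finite dimensional algebra A / J: writing
  a = c + j in the product a g of a coefficient and a generator of \<open>I\<close>, the term j g
  falls into \<open>K\<close>. Asking only that the subspace \<open>K\<close> contain the products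
  lets the lemma cover intersections and annihilators as well.\<close>

lemma finite_codimension_product:
  fixes I J K :: "'a::complex_comm_algebra_1 set"
  assumes fg: "finitely_generated_algebra TYPE('a)"
    and I: "algebra_ideal I" "finite_codimension I" and J: "algebra_ideal J" "finite_codimension J"
    and K: "csubspace K" and prod: "\<And>x y. x \<in> I \<Longrightarrow> y \<in> J \<Longrightarrow> x * y \<in> K"
  shows "finite_codimension K"
proof -
  obtain G where G: "finite G" "G \<subseteq> I" "I \<subseteq> cspan {a * g | a g. g \<in> G}"
    using finite_codimension_ideal_finitely_generated[OF fg I] .
  obtain B where B: "finite B" "cspan (B \<union> I) = UNIV"
    using I(2) unfolding finite_codimension_def by blast
  obtain C where C: "finite C" "cspan (C \<union> J) = UNIV"
    using J(2) unfolding finite_codimension_def by blast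
  have sJ: "csubspace J" and sI: "csubspace I" using J I by (auto simp: algebra_ideal_def)
  define D where "D = B \<union> (\<lambda>(c, g). c * g) ` (C \<times> G)"
  have "a * g \<in> cspan (D \<union> K)" if "g \<in> G" for a g
  proof -
    obtain c j where cj: "c \<in> cspan C" "j \<in> J" "a = c + j"
      using cspan_Un_ideal_decomp[OF C(2) sJ] .
    have "g * j \<in> K" using prod G(2) that cj by blast
    then have "j * g \<in> cspan (D \<union> K)" by (simp add: mult.commute cvec.span_base)
    moreover have "c * g \<in> cspan (D \<union> K)"
      using cj(1)
    proof (rule clinear_in_subspace[rotated 3])
      show "x * g \<in> cspan (D \<union> K)" if "x \<in> C" for x
        using that \<open>g \<in> G\<close> by (intro cvec.span_base) (auto simp: D_def)
    qed (auto simp: clinear_iff distrib_right mult_scaleC_left)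
    ultimately show ?thesis using cj(3) by (simp add: distrib_right cvec.span_add)
  qed
  then have "cspan {a * g | a g. g \<in> G} \<subseteq> cspan (D \<union> K)"
    by (intro cvec.span_minimal) auto
  then have "I \<subseteq> cspan (D \<union> K)" using G by blast
  moreover have "B \<subseteq> cspan (D \<union> K)" by (auto simp: D_def intro: cvec.span_base)
  ultimately have "cspan (B \<union> I) \<subseteq> cspan (D \<union> K)" by (intro cvec.span_minimal) auto
  then have "cspan (D \<union> K) = UNIV" using B by auto
  moreover have "finite D" using B C G by (simp add: D_def)
  ultimately show ?thesis unfolding finite_codimension_def by blast
qed

text \<open>Powers of \<open>I\<close> are never formed. The induction passes from \<open>K\<close>
  to the colon ideal (K : I), called \<open>L\<close>, which contains all products with one factor
  fewer and satisfies I L \<subseteq> K.\<close>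

lemma finite_codimension_power:
  fixes I K :: "'a::complex_comm_algebra_1 set"
  assumes fg: "finitely_generated_algebra TYPE('a)"
    and I: "algebra_ideal I" "finite_codimension I"
    and K: "algebra_ideal K"
    and prod: "\<And>as. set as \<subseteq> I \<Longrightarrow> length as = m \<Longrightarrow> prod_list as \<in> K"
  shows "finite_codimension K"
  using K prod
proof (induction m arbitrary: K)
  case 0
  then have "1 \<in> K" by force
  then have "K = UNIV" using 0(1) by (metis UNIV_eq_I algebra_ideal_def mult.right_neutral)
  then show ?case unfolding finite_codimension_def by (metis Un_UNIV_right cvec.span_UNIV finite.emptyI)
next
  case (Suc m)
  have sK: "csubspace K" using Suc by (simp add: algebra_ideal_def)
  define L where "L = {a. \<forall>x\<in>I. x * a \<in> K}"
  have L: "algebra_ideal L"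
    using Suc.prems(1) sK unfolding L_def algebra_ideal_def
    by (auto simp: distrib_left mult_scaleC_right mult.left_commute cvec.subspace_0
        cvec.subspace_add cvec.subspace_scale intro!: cvec.subspaceI)
  have "finite_codimension L"
  proof (rule Suc.IH[OF L])
    fix as assume as: "set as \<subseteq> I" "length as = m"
    show "prod_list as \<in> L"
      unfolding L_def using Suc.prems(2)[of "x # as" for x] as by auto
  qed
  then show ?case
    using finite_codimension_product[OF fg I L _ sK] by (auto simp: L_def)
qed

text \<open>An intersection of two ideals contains their product.\<close>

lemma finite_codimension_INT:
  fixes K :: "'i \<Rightarrow> 'a::complex_comm_algebra_1 set"
  assumes fg: "finitely_generated_algebra TYPE('a)"
    and "finite F" "\<And>i. i \<in> F \<Longrightarrow> algebra_ideal (K i) \<and> finite_codimension (K i)"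
  shows "algebra_ideal (\<Inter>i\<in>F. K i) \<and> finite_codimension (\<Inter>i\<in>F. K i)"
  using assms(2,3)
proof (induction F)
  case empty
  show ?case unfolding finite_codimension_def
    by (auto simp: algebra_ideal_UNIV intro!: exI[of _ "{}"])
next
  case (insert i F)
  let ?L = "\<Inter>i\<in>F. K i"
  have ideals: "algebra_ideal (K i)" "finite_codimension (K i)" "algebra_ideal ?L" "finite_codimension ?L"
    using insert by auto
  then have *: "algebra_ideal (K i \<inter> ?L)"
    unfolding algebra_ideal_def by (auto intro: cvec.subspace_inter)
  have "finite_codimension (K i \<inter> ?L)"
  proof (rule finite_codimension_product[OF fg ideals])
    show "csubspace (K i \<inter> ?L)" using * by (simp add: algebra_ideal_def)
    show "x * y \<in> K i \<inter> ?L" if "x \<in> K i" "y \<in> ?L" for x y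
      using that ideals unfolding algebra_ideal_def by (metis IntI mult.commute)
  qed
  then show ?case using * by simp
qed


section \<open>Operators indexed by matrix units\<close>

lemma koszul_simps [simp]: "koszul 0 q = 1" "koszul p 0 = 1" "koszul 1 1 = -1"
  by (simp_all add: koszul_def)

text \<open>The operator \<open>X p a i j\<close> is the action of \<open>E\<^sub>i\<^sub>j \<otimes> a\<close>, with the matrix unit \<open>E\<^sub>i\<^sub>j\<close> taken in parity \<open>p\<close>.\<close>

locale queer_operators =
  fixes X :: "bit \<Rightarrow> 'a::complex_comm_algebra_1 \<Rightarrow> 'n::{finite, linorder} \<Rightarrow> 'n \<Rightarrow> 'w \<Rightarrow> 'w::complex_vector"
    and H :: "'w set" and \<phi> :: "'n \<Rightarrow> 'a \<Rightarrow> complex" and I :: "'a set"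
  assumes X_linear: "clinear (X p a i j)"
    and X_add: "X p (a + b) i j v = X p a i j v + X p b i j v"
    and X_scale: "X p (c *\<^sub>C a) i j v = c *\<^sub>C X p a i j v"
    and X_bracket: "X p a i j (X q b k l v) = koszul p q *\<^sub>C X q b k l (X p a i j v)
      + (if j = k then X (p + q) (a * b) i l v else 0)
      - koszul p q *\<^sub>C (if l = i then X (p + q) (a * b) k j v else 0)"
    and H_finite: "\<exists>B. finite B \<and> B \<subseteq> H \<and> H \<subseteq> cspan B"
    and H_upper: "h \<in> H \<Longrightarrow> i < j \<Longrightarrow> X p a i j h = 0"
    and H_diagonal: "h \<in> H \<Longrightarrow> X p a i i h \<in> H"
    and H_weight: "h \<in> H \<Longrightarrow> X 0 a i i h = \<phi> i a *\<^sub>C h"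
    and fg: "finitely_generated_algebra TYPE('a)"
    and I_ideal: "algebra_ideal I" and I_cofinite: "finite_codimension I"
    and I_weight: "a \<in> I \<Longrightarrow> \<phi> i a = 0"
    and H_integrable: "i \<in> index_set \<Longrightarrow> \<exists>m. \<forall>h\<in>H. (X 0 1 (next_index i) i ^^ m) h = 0"
begin

lemma X_lin:
  "X p a i j (v + w) = X p a i j v + X p a i j w"
  "X p a i j (v - w) = X p a i j v - X p a i j w"
  "X p a i j (c *\<^sub>C v) = c *\<^sub>C X p a i j v"
  "X p a i j 0 = 0"
  "X p a i j (- v) = - X p a i j v"
  "X p a i j (sum f F) = (\<Sum>x\<in>F. X p a i j (f x))"
proof -
  interpret L: Vector_Spaces.linear scaleC scaleC "X p a i j" by (rule X_linear)
  show "X p a i j (v + w) = X p a i j v + X p a i j w"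
  "X p a i j (v - w) = X p a i j v - X p a i j w"
  "X p a i j (c *\<^sub>C v) = c *\<^sub>C X p a i j v"
  "X p a i j 0 = 0"
  "X p a i j (- v) = - X p a i j v"
  "X p a i j (sum f F) = (\<Sum>x\<in>F. X p a i j (f x))"
    by (simp_all add: L.add L.diff L.scale L.zero L.neg L.sum)
qed

lemma sum_list_const: "(\<Sum>x\<leftarrow>xs. w) = of_nat (length xs) *\<^sub>C (w :: 'w)"
  by (induction xs) (simp_all add: scaleC_add_left scaleC_one)

lemma X_sum_list: "X p a i j (sum_list (map f xs)) = (\<Sum>x\<leftarrow>xs. X p a i j (f x))"
  by (induction xs) (simp_all add: X_lin)

lemma X_zero: "X p 0 i j v = 0"
  using X_scale[of p 0 0 i j v] by simp

lemmas even_bracket = X_bracket[where p = 0, simplified scaleC_one koszul_simps add_0]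

end

section \<open>The copy of sl2 \<otimes> A attached to an even positive root, simple or not\<close>

locale root_operators = queer_operators X H \<phi> I
  for X :: "bit \<Rightarrow> 'a::complex_comm_algebra_1 \<Rightarrow> 'n::{finite, linorder} \<Rightarrow> 'n \<Rightarrow> 'w \<Rightarrow> 'w::complex_vector"
    and H \<phi> I +
  fixes i j :: 'n
  assumes less: "i < j"
begin

abbreviation "E a \<equiv> X 0 a i j"
abbreviation "F a \<equiv> X 0 a j i"
definition "h a v = X 0 a i i v - X 0 a j j v"

lemma E_F: "E a (F b v) = F b (E a v) + h (a * b) v"
  using even_bracket[of a i j 0 b j i v] less by (simp add: scaleC_one h_def)

lemma F_F: "F a (F b v) = F b (F a v)"
  using even_bracket[of a j i 0 b j i v] less by (simp add: scaleC_one)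

lemma h_F: "h c (F b v) = F b (h c v) + (-2) *\<^sub>C F (c * b) v"
proof -
  have "(-2) *\<^sub>C F (c * b) v = - (F (c * b) v) - F (c * b) v"
    using cvec.scale_left_distrib[of "-1" "-1" "F (c * b) v"] by (simp add: scaleC_one)
  then show ?thesis
    using even_bracket[of c i i 0 b j i v] even_bracket[of c j j 0 b j i v] less_imp_neq[OF less]
    by (simp add: scaleC_one h_def X_lin mult.commute)
qed

lemma h_H: "v \<in> H \<Longrightarrow> h c v = (\<phi> i c - \<phi> j c) *\<^sub>C v"
  by (simp add: h_def H_weight cvec.scale_left_diff_distrib)

abbreviation "Fword bs \<equiv> foldr F bs"

text \<open>Moving \<open>h c\<close> past one letter \<open>F b\<close> leaves -2 times the word
  with \<open>b\<close> replaced by \<open>c * b\<close>, so each letter contributes one word. Only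
  the length, the product and the number of the new words are recorded: these determine the result
  once enough operators \<open>E\<close> have been applied.\<close>

lemma h_Fword:
  assumes "v \<in> H"
  shows "\<exists>L. h c (Fword bs v) = (\<phi> i c - \<phi> j c) *\<^sub>C Fword bs v + (-2) *\<^sub>C (\<Sum>bs'\<leftarrow>L. Fword bs' v)
    \<and> (\<forall>bs'\<in>set L. length bs' = length bs \<and> prod_list bs' = c * prod_list bs) \<and> length L = length bs"
proof (induction bs)
  case Nil
  show ?case using assms by (intro exI[of _ "[]"]) (simp add: h_H)
next
  case (Cons b bs)
  then obtain L where L: "h c (Fword bs v) = (\<phi> i c - \<phi> j c) *\<^sub>C Fword bs v + (-2) *\<^sub>C (\<Sum>bs'\<leftarrow>L. Fword bs' v)"
    "\<forall>bs'\<in>set L. length bs' = length bs \<and> prod_list bs' = c * prod_list bs" "length L = length bs"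
    by blast
  show ?case
  proof (intro exI conjI)
    show "h c (Fword (b # bs) v) = (\<phi> i c - \<phi> j c) *\<^sub>C Fword (b # bs) v
        + (-2) *\<^sub>C (\<Sum>bs'\<leftarrow>((c * b) # bs) # map ((#) b) L. Fword bs' v)"
      by (simp add: h_F L(1) X_lin X_sum_list scaleC_add_right o_def)
  qed (use L in \<open>auto simp: mult_ac\<close>)
qed

text \<open>The number of summands matters: in \<open>E_list_Fword\<close> all of them become equal, and they must not
  cancel.\<close>

lemma E_Fword:
  assumes "v \<in> H" "a \<in> I"
  shows "\<exists>L. E a (Fword bs v) = (-2) *\<^sub>C (\<Sum>bs'\<leftarrow>L. Fword bs' v)
    \<and> (\<forall>bs'\<in>set L. length bs' = length bs - 1 \<and> prod_list bs' = a * prod_list bs)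
    \<and> length L = length bs choose 2"
proof (induction bs)
  case Nil
  show ?case using assms less by (intro exI[of _ "[]"]) (simp add: H_upper)
next
  case (Cons b bs)
  have ab: "a * b \<in> I" using assms(2) I_ideal by (metis algebra_ideal_def mult.commute)
  obtain L where L: "E a (Fword bs v) = (-2) *\<^sub>C (\<Sum>bs'\<leftarrow>L. Fword bs' v)"
    "\<forall>bs'\<in>set L. length bs' = length bs - 1 \<and> prod_list bs' = a * prod_list bs"
    "length L = length bs choose 2"
    using Cons by blast
  \<comment> \<open>Since \<open>a * b\<close> lies in \<open>I\<close>, the weight term of
    \<open>h_Fword\<close> vanishes. By Pascal's rule the words in \<open>K\<close> and those coming
    from \<open>L\<close> have the right total number.\<close>
  obtain K where K: "h (a * b) (Fword bs v) = (-2) *\<^sub>C (\<Sum>bs'\<leftarrow>K. Fword bs' v)"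
    "\<forall>bs'\<in>set K. length bs' = length bs \<and> prod_list bs' = (a * b) * prod_list bs" "length K = length bs"
    using h_Fword[OF assms(1), of "a * b" bs] I_weight[OF ab] by auto
  show ?case
  proof (intro exI conjI)
    show "E a (Fword (b # bs) v) = (-2) *\<^sub>C (\<Sum>bs'\<leftarrow>K @ map ((#) b) L. Fword bs' v)"
      by (simp add: E_F L(1) K(1) X_lin X_sum_list scaleC_add_right o_def add.commute)
    show "\<forall>bs'\<in>set (K @ map ((#) b) L). length bs' = length (b # bs) - 1
      \<and> prod_list bs' = a * prod_list (b # bs)"
    \<comment> \<open>For empty \<open>bs\<close> the truncated subtraction would give the words
      \<open>b # bs'\<close> the wrong length, but then \<open>L\<close> is empty because 0 choose 2
      is 0.\<close>
    proof (cases bs)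
      case Nil
      then have "L = []" using L(3) by (simp add: numeral_2_eq_2)
      then show ?thesis using K by (auto simp: mult_ac)
    qed (use K L in \<open>auto simp: mult_ac\<close>)
    show "length (K @ map ((#) b) L) = length (b # bs) choose 2"
      using K L by (simp add: numeral_2_eq_2)
  qed
qed

text \<open>Each \<open>E a\<close> shortens the words by one letter and multiplies their product by
  \<open>a\<close>, until a single letter is left. The scalar is chosen before \<open>bs\<close>, so
  the induction hypothesis takes the same value on all words created by the first operator, and
  these equal summands add up. The operator that acts first stands last in \<open>as\<close>, hence
  the reverse induction.\<close>

lemma E_list_Fword:
  assumes "v \<in> H" "set as \<subseteq> I"
  shows "\<exists>r. r \<noteq> 0 \<and> (\<forall>bs. length bs = Suc (length as) \<longrightarrow>
    foldr E as (Fword bs v) = r *\<^sub>C F (prod_list as * prod_list bs) v)"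
  using assms(2)
proof (induction as rule: rev_induct)
  case Nil
  then show ?case by (intro exI[of _ 1]) (auto simp: length_Suc_conv scaleC_one)
next
  case (snoc a as)
  then obtain r where r: "r \<noteq> 0" "\<And>bs. length bs = Suc (length as) \<Longrightarrow>
    foldr E as (Fword bs v) = r *\<^sub>C F (prod_list as * prod_list bs) v" by auto
  let ?n = "Suc (Suc (length as)) choose 2"
  have lin: "foldr E as (c *\<^sub>C w) = c *\<^sub>C foldr E as w"
    "foldr E as (\<Sum>bs\<leftarrow>L. Fword bs v) = (\<Sum>bs\<leftarrow>L. foldr E as (Fword bs v))" for c w L
  proof -
    show s: "foldr E as (c *\<^sub>C w) = c *\<^sub>C foldr E as w" for c w
      by (induction as) (simp_all add: X_lin)
    have "foldr E as (w + w') = foldr E as w + foldr E as w'" for w w'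
      by (induction as) (simp_all add: X_lin)
    then show "foldr E as (\<Sum>bs\<leftarrow>L. Fword bs v) = (\<Sum>bs\<leftarrow>L. foldr E as (Fword bs v))"
      using s[of 0 0] by (induction L) simp_all
  qed
  show ?case
  proof (intro exI conjI allI impI)
    have "?n \<noteq> 0" by simp
    then show "-2 * of_nat ?n * r \<noteq> 0" using r by simp
    fix bs :: "'a list" assume bs: "length bs = Suc (length (as @ [a]))"
    obtain L where L: "E a (Fword bs v) = (-2) *\<^sub>C (\<Sum>bs'\<leftarrow>L. Fword bs' v)"
      "\<forall>bs'\<in>set L. length bs' = length bs - 1 \<and> prod_list bs' = a * prod_list bs"
      "length L = length bs choose 2"
      using E_Fword[OF assms(1), of a bs] snoc.prems by auto
    have "map (\<lambda>bs'. foldr E as (Fword bs' v)) L =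
        map (\<lambda>_. r *\<^sub>C F (prod_list as * (a * prod_list bs)) v) L"
      using r(2) L(2) bs by (intro map_cong) auto
    then have "(\<Sum>bs'\<leftarrow>L. foldr E as (Fword bs' v)) =
        (\<Sum>_\<leftarrow>L. r *\<^sub>C F (prod_list as * (a * prod_list bs)) v)"
      by (rule arg_cong)
    then have "(\<Sum>bs'\<leftarrow>L. foldr E as (Fword bs' v)) =
        of_nat (length L) *\<^sub>C r *\<^sub>C F (prod_list as * (a * prod_list bs)) v"
      by (simp only: sum_list_const)
    moreover have "foldr E (as @ [a]) (Fword bs v) = (-2) *\<^sub>C (\<Sum>bs'\<leftarrow>L. foldr E as (Fword bs' v))"
      by (simp only: foldr_append foldr_Cons foldr_Nil o_apply id_apply L(1) lin)
    ultimately show "foldr E (as @ [a]) (Fword bs v)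
        = (-2 * of_nat ?n * r) *\<^sub>C F (prod_list (as @ [a]) * prod_list bs) v"
      using L(3) bs by (simp add: mult.assoc)
  qed
qed

lemma power_ideal_kills:
  assumes "(F 1 ^^ Suc m) v = 0" "v \<in> H" "set as \<subseteq> I" "length as = m"
  shows "F (prod_list as) v = 0"
proof -
  obtain r where r: "r \<noteq> 0" "foldr E as (Fword (replicate (Suc m) 1) v) =
      r *\<^sub>C F (prod_list as * prod_list (replicate (Suc m) 1)) v"
    using E_list_Fword[OF assms(2,3)] assms(4) by (metis length_replicate)
  moreover have "foldr E as 0 = 0" by (induction as) (simp_all add: X_lin)
  moreover have "prod_list (replicate k (1::'a)) = 1" for k by (induction k) auto
  ultimately show ?thesis using assms(1) by (simp add: foldr_replicate)
qed

lemma h_F_power: "h c ((F 1 ^^ n) v) = (F 1 ^^ n) (h c v) + (-2 * of_nat n) *\<^sub>C (F 1 ^^ (n - 1)) (F c v)"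
proof (induction n)
  case (Suc n)
  have "(F 1 ^^ k) (F c v) = F c ((F 1 ^^ k) v)" for k
    by (induction k) (simp_all, metis F_F)
  then have F: "F c ((F 1 ^^ n) v) = (F 1 ^^ n) (F c v)" by simp
  \<comment> \<open>For \<open>n = 0\<close> the truncated \<open>n - 1\<close> is harmless because
    the coefficient is zero.\<close>
  have shift: "(-2 * of_nat n) *\<^sub>C F 1 ((F 1 ^^ (n - 1)) w) = (-2 * of_nat n) *\<^sub>C (F 1 ^^ n) w" for w
    by (cases n) simp_all
  have "h c ((F 1 ^^ Suc n) v) = F 1 (h c ((F 1 ^^ n) v)) + (-2) *\<^sub>C (F 1 ^^ n) (F c v)"
    using h_F[of c 1 "(F 1 ^^ n) v"] F by simp
  also have "\<dots> = (F 1 ^^ Suc n) (h c v)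
      + ((-2 * of_nat n) *\<^sub>C (F 1 ^^ n) (F c v) + (-2) *\<^sub>C (F 1 ^^ n) (F c v))"
    unfolding Suc X_lin shift by (simp add: add.assoc)
  also have "(-2 * of_nat n) *\<^sub>C (F 1 ^^ n) (F c v) + (-2) *\<^sub>C (F 1 ^^ n) (F c v)
      = (-2 * of_nat (Suc n)) *\<^sub>C (F 1 ^^ (Suc n - 1)) (F c v)"
    unfolding scaleC_add_left[symmetric] by (simp add: algebra_simps)
  finally show ?case .
qed (simp add: h_def)

text \<open>Each step trades one factor \<open>F 1\<close> for a factor \<open>F c\<close>. Apply
  \<open>h c\<close> to the vanishing vector \<open>(F 1 ^^ n) (Fword cs v)\<close>: moved to the
  inside it produces words of the same length as \<open>cs\<close>, which vanish by induction, so
  the commutator term, with coefficient -2n and n nonzero, vanishes too.\<close>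

lemma Fword_vanishes:
  assumes "\<forall>v\<in>H. (F 1 ^^ N) v = 0" "v \<in> H" "length bs \<le> N"
  shows "(F 1 ^^ (N - length bs)) (Fword bs v) = 0"
  using assms(3)
proof (induction "length bs" arbitrary: bs)
  case 0
  then show ?case using assms by simp
next
  case (Suc r)
  then obtain c cs where bs: "bs = c # cs" "length cs = r" by (metis length_Suc_conv)
  define n where "n = N - r"
  have n: "n \<noteq> 0" "n - 1 = N - length bs" using Suc bs by (auto simp: n_def)
  have IH: "(F 1 ^^ n) (Fword cs' v) = 0" if "length cs' = r" for cs'
    using Suc.hyps(1)[of cs'] Suc.prems bs that by (simp add: n_def)
  obtain L where L: "h c (Fword cs v) = (\<phi> i c - \<phi> j c) *\<^sub>C Fword cs v + (-2) *\<^sub>C (\<Sum>bs'\<leftarrow>L. Fword bs' v)"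
    "\<forall>bs'\<in>set L. length bs' = length cs"
    using h_Fword[OF assms(2), of c cs] by blast
  interpret P: Vector_Spaces.linear scaleC scaleC "F 1 ^^ n"
    by (intro clinear_funpow X_linear)
  have "(F 1 ^^ n) (\<Sum>bs'\<leftarrow>L. Fword bs' v) = 0"
    using L(2) IH bs(2) by (induction L) (simp_all add: P.zero P.add)
  then have "(F 1 ^^ n) (h c (Fword cs v)) = 0"
    using IH[OF bs(2)] by (simp only: L(1) P.add P.scale) simp
  moreover have "h c ((F 1 ^^ n) (Fword cs v)) = 0"
    using IH[OF bs(2)] by (simp add: h_def X_lin)
  ultimately have "(-2 * of_nat n) *\<^sub>C (F 1 ^^ (n - 1)) (F c (Fword cs v)) = 0"
    using h_F_power[of c n "Fword cs v"] by simp
  then show ?case using n bs by simp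
qed

lemma F_power_vanishes: "\<forall>v\<in>H. (F 1 ^^ N) v = 0 \<Longrightarrow> v \<in> H \<Longrightarrow> (F b ^^ N) v = 0"
  using Fword_vanishes[of N v "replicate N b"] by (simp add: foldr_replicate)

end


section \<open>Nilpotency and finiteness\<close>

lemma funpow_zero_mono:
  fixes f :: "'v::complex_vector \<Rightarrow> 'v"
  assumes "clinear f" "(f ^^ m) v = 0" "m \<le> n"
  shows "(f ^^ n) v = 0"
proof -
  have "(f ^^ n) v = (f ^^ (n - m)) ((f ^^ m) v)"
    using assms(3) by (metis comp_apply funpow_add le_add_diff_inverse2)
  moreover have "(f ^^ (n - m)) 0 = 0"
  proof -
    interpret P: Vector_Spaces.linear scaleC scaleC "f ^^ (n - m)"
      using assms(1) by (rule clinear_funpow)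
    show ?thesis by (rule P.zero)
  qed
  ultimately show ?thesis using assms(2) by simp
qed

text \<open>Everything rests on x y^(b+1) - y^(b+1) x = (b+1) z y^b with \<open>z\<close> central.
  First, y^b x^a v = 0 for b \<ge> m + a, by induction on \<open>a\<close>; together with x^m v = 0
  this gives y^b x^a v = 0 for b \<ge> 2m and every \<open>a\<close>. Then the commutator formula
  trades a factor \<open>y\<close> for a factor \<open>z\<close>, so z^c y^b x^a v = 0 whenever b +
  c \<ge> 2m. The claim is the case a = b = 0.\<close>

lemma heisenberg_nilpotent:
  fixes x y z :: "'v::complex_vector \<Rightarrow> 'v"
  assumes lin: "clinear x" "clinear y" "clinear z"
    and xy: "\<And>v. x (y v) = y (x v) + z v"
    and xz: "\<And>v. x (z v) = z (x v)" and yz: "\<And>v. y (z v) = z (y v)"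
    and x0: "(x ^^ m) v = 0" and y0: "(y ^^ m) v = 0"
  shows "(z ^^ (2 * m)) v = 0"
proof -
  interpret x: Vector_Spaces.linear scaleC scaleC x by fact
  interpret y: Vector_Spaces.linear scaleC scaleC y by fact
  interpret z: Vector_Spaces.linear scaleC scaleC z by fact
  have zy: "z ((y ^^ b) u) = (y ^^ b) (z u)" for b u
    by (induction b) (simp_all flip: yz)
  have xyb: "x ((y ^^ Suc b) u) = (y ^^ Suc b) (x u) + of_nat (Suc b) *\<^sub>C z ((y ^^ b) u)" for b u
  proof (induction b)
    case 0
    show ?case by (simp add: xy scaleC_one)
  next
    case (Suc b)
    have "x ((y ^^ Suc (Suc b)) u) = y (x ((y ^^ Suc b) u)) + z ((y ^^ Suc b) u)"
      by (simp add: xy)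
    also have "\<dots> = (y ^^ Suc (Suc b)) (x u) +
        (of_nat (Suc b) *\<^sub>C z ((y ^^ Suc b) u) + 1 *\<^sub>C z ((y ^^ Suc b) u))"
      unfolding Suc by (simp add: y.add y.scale yz scaleC_one)
    finally show ?case unfolding scaleC_add_left[symmetric] by (simp add: add.commute)
  qed
  have yx: "(y ^^ b) ((x ^^ a) v) = 0" if "m + a \<le> b" for a b
    using that
  proof (induction a arbitrary: b)
    case 0
    then show ?case using funpow_zero_mono[OF lin(2) y0] by simp
  next
    case (Suc a)
    then obtain b' where b: "b = Suc b'" by (cases b) auto
    have "(y ^^ b) ((x ^^ a) v) = 0" "(y ^^ b') ((x ^^ a) v) = 0" using Suc b by auto
    then show ?case using xyb[of b' "(x ^^ a) v"] b by (simp add: x.zero z.zero)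
  qed
  have yx': "(y ^^ b) ((x ^^ a) v) = 0" if "2 * m \<le> b" for a b
  proof (cases "m \<le> a")
    case True
    interpret P: Vector_Spaces.linear scaleC scaleC "y ^^ b" by (intro clinear_funpow lin)
    show ?thesis using funpow_zero_mono[OF lin(1) x0 True] by (simp add: P.zero)
  next
    case False
    then show ?thesis using that by (intro yx) auto
  qed
  have xzc: "x ((z ^^ c) u) = (z ^^ c) (x u)" for c u
    by (induction c) (simp_all add: xz)
  have "(z ^^ c) ((y ^^ b) ((x ^^ a) v)) = 0" if "2 * m \<le> b + c" for a b c
    using that
  proof (induction c arbitrary: a b)
    case 0
    then show ?case using yx' by simp
  next
    case (Suc c)
    interpret P: Vector_Spaces.linear scaleC scaleC "z ^^ c" by (intro clinear_funpow lin)
    have "(z ^^ c) ((y ^^ Suc b) ((x ^^ a) v)) = 0" "(z ^^ c) ((y ^^ Suc b) ((x ^^ Suc a) v)) = 0"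
      using Suc.prems by (auto intro!: Suc.IH simp del: funpow.simps)
    moreover have "(z ^^ c) (x ((y ^^ Suc b) ((x ^^ a) v))) = (z ^^ c) ((y ^^ Suc b) ((x ^^ Suc a) v))
        + of_nat (Suc b) *\<^sub>C (z ^^ Suc c) ((y ^^ b) ((x ^^ a) v))"
      unfolding xyb by (simp only: P.add P.scale funpow_Suc_right o_apply funpow.simps)
        (simp add: funpow_swap1)
    ultimately have "of_nat (Suc b) *\<^sub>C (z ^^ Suc c) ((y ^^ b) ((x ^^ a) v)) = 0"
      using xzc by (metis add_0 x.zero)
    then show ?case using of_nat_eq_0_iff[of "Suc b", where 'a = complex]
      by (simp del: of_nat_Suc funpow.simps)
  qed
  from this[of 0 "2 * m" 0] show ?thesis by simp
qed

lemma finite_bit: "finite (UNIV :: bit set)"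
proof -
  have "UNIV = {0, 1 :: bit}" by (rule UNIV_eq_I) auto
  then show ?thesis by (metis finite.emptyI finite.insertI)
qed

lemma next_index:
  fixes i j :: "'n::{finite, linorder}"
  assumes "i < j"
  shows "i < next_index i" "next_index i \<le> j" "i \<in> index_set"
proof -
  have "next_index i = Min {j. i < j}"
    unfolding next_index_def using assms by (intro Least_Min) auto
  moreover have "Min {j. i < j} \<in> {j. i < j}" using assms by (intro Min_in) auto
  moreover have "Min {j. i < j} \<le> j" using assms by (intro Min_le) auto
  ultimately show "i < next_index i" "next_index i \<le> j" by auto
  show "i \<in> index_set" using assms by (auto simp: index_set_def)
qed

text \<open>A positive root that is not simple splits at \<open>next_index i\<close> into a simple
  root and a root with fewer indices in its interval.\<close>

lemma root_induct [consumes 1, case_names simple sum]: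
  fixes i j :: "'n::{finite, linorder}"
  assumes "i < j"
    and simple: "\<And>i. i \<in> index_set \<Longrightarrow> i < next_index i \<Longrightarrow> P i (next_index i)"
    and sum: "\<And>i s j. i < s \<Longrightarrow> s < j \<Longrightarrow> P i s \<Longrightarrow> P s j \<Longrightarrow> P i j"
  shows "P i j"
  using assms(1)
proof (induction "card {i<..j}" arbitrary: i rule: less_induct)
  case less
  let ?s = "next_index i"
  note s = next_index[OF less.prems]
  show ?case
  proof (cases "?s = j")
    case True
    then show ?thesis using simple s by metis
  next
    case False
    then have "?s < j" using s by auto
    moreover have "card {?s<..j} < card {i<..j}"
      using s by (intro psubset_card_mono psubsetI) auto
    ultimately show ?thesis using less.hyps sum simple s by metis
  qed
qed

section \<open>Negative root vectors on H and the span of the words in them\<close>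

context queer_operators begin

lemma root_operators: "i < j \<Longrightarrow> root_operators X H \<phi> I i j"
  by unfold_locales

text \<open>The coefficient 1 is enough here: \<open>F_power_vanishes\<close> passes to an arbitrary
  coefficient for the same root.\<close>

lemma root_nilpotent: "i < j \<Longrightarrow> \<exists>m. \<forall>h\<in>H. (X 0 1 j i ^^ m) h = 0"
proof (induction i j rule: root_induct)
  case (simple i)
  then show ?case using H_integrable by blast
next
  case (sum i s j)
  then obtain m n where mn: "\<forall>h\<in>H. (X 0 1 s i ^^ m) h = 0" "\<forall>h\<in>H. (X 0 1 j s ^^ n) h = 0" by blast
  have "(X 0 1 j i ^^ (2 * max m n)) h = 0" if "h \<in> H" for h
  proof (rule heisenberg_nilpotent[OF X_linear X_linear X_linear])
    have ne: "i \<noteq> s" "s \<noteq> j" "i \<noteq> j" using sum by auto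
    show "X 0 1 j s (X 0 1 s i v) = X 0 1 s i (X 0 1 j s v) + X 0 1 j i v" for v
      using even_bracket[of 1 j s 0 1 s i v] ne by simp
    show "X 0 1 j s (X 0 1 j i v) = X 0 1 j i (X 0 1 j s v)" for v
      using even_bracket[of 1 j s 0 1 j i v] ne by simp
    show "X 0 1 s i (X 0 1 j i v) = X 0 1 j i (X 0 1 s i v)" for v
      using even_bracket[of 1 s i 0 1 j i v] ne by simp
  qed (use mn that in \<open>auto intro: funpow_zero_mono[OF X_linear]\<close>)
  then show ?case by blast
qed

definition kill :: "'n \<Rightarrow> 'n \<Rightarrow> 'a set"
  where "kill j i = {a. \<forall>p. \<forall>h\<in>H. X p a j i h = 0}"

text \<open>The odd root vector is the bracket of the odd Cartan element E_jj \<otimes> 1 with the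
  even root vector, and that Cartan element maps \<open>H\<close> to itself. So the even case
  decides.\<close>

lemma killI:
  assumes "i < j" and 0: "\<And>h. h \<in> H \<Longrightarrow> X 0 a j i h = 0"
  shows "a \<in> kill j i"
proof -
  have "X 1 a j i h = 0" if "h \<in> H" for h
    using X_bracket[of 1 1 j j 0 a j i h] 0[OF that] 0[OF H_diagonal[OF that]] less_imp_neq[OF assms(1)]
    by (simp add: X_lin scaleC_one)
  then have "X p a j i h = 0" if "h \<in> H" for p h
    using 0 that by (cases "p = 0") auto
  then show ?thesis by (simp add: kill_def)
qed

text \<open>Multiplication of the coefficient by \<open>c\<close> is the bracket with the even
  Cartan element E_jj \<otimes> c, which preserves \<open>H\<close>.\<close>

lemma kill_ideal: assumes "i < j" shows "algebra_ideal (kill j i)"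
  unfolding algebra_ideal_def
proof (intro conjI allI ballI cvec.subspaceI)
  fix c a assume a: "a \<in> kill j i"
  show "c * a \<in> kill j i"
  proof (rule killI[OF assms])
    fix h assume "h \<in> H"
    then show "X 0 (c * a) j i h = 0"
      using a H_diagonal[of h 0 c j] less_imp_neq[OF assms] even_bracket[of c j j 0 a j i h]
      by (simp add: kill_def X_lin)
  qed
qed (simp_all add: kill_def X_zero X_add X_scale)

lemma kill_mult:
  assumes "i < s" "s < j" "a \<in> kill j s" "b \<in> kill s i"
  shows "a * b \<in> kill j i"
proof (rule killI)
  fix h assume "h \<in> H"
  then show "X 0 (a * b) j i h = 0"
    using assms even_bracket[of a j s 0 b s i h] by (auto simp: kill_def X_lin)
qed (use assms in auto)

lemma kill_cofinite: "i < j \<Longrightarrow> finite_codimension (kill j i)"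
proof (induction i j rule: root_induct)
  case (simple i)
  interpret R: root_operators X H \<phi> I i "next_index i" by (rule root_operators) fact
  obtain m where m: "\<forall>h\<in>H. (X 0 1 (next_index i) i ^^ m) h = 0"
    using simple H_integrable by blast
  have m: "(X 0 1 (next_index i) i ^^ Suc m) h = 0" if "h \<in> H" for h
    by (rule funpow_zero_mono[OF X_linear, of m]) (use m that in auto)
  show ?case
  proof (rule finite_codimension_power[OF fg I_ideal I_cofinite kill_ideal[OF simple(2)]])
    show "prod_list as \<in> kill (next_index i) i" if "set as \<subseteq> I" "length as = m" for as
      using R.power_ideal_kills[OF m _ that] by (intro killI[OF simple(2)])
  qed
next
  case (sum i s j)
  then have "i < j" by simp
  then have "csubspace (kill j i)" using kill_ideal by (simp add: algebra_ideal_def)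
  then show ?case
    by (rule finite_codimension_product[OF fg kill_ideal[OF sum(2)] sum.IH(2) kill_ideal[OF sum(1)] sum.IH(1)])
      (rule kill_mult[OF sum(1,2)])
qed

definition J :: "'a set"
  where "J = (\<Inter>(j, i)\<in>{(j, i). i < j}. kill j i)"

lemma J: "algebra_ideal J" "finite_codimension J"
  using finite_codimension_INT[OF fg, of "{(j, i). i < j}" "\<lambda>(j, i). kill j i"]
    kill_ideal kill_cofinite by (auto simp: J_def)

text \<open>A bare set of vectors, so that inductions follow the words. Its span plays the role of
  U(n^- \<otimes> A) H; that it is a module for the whole algebra is
  \<open>U_stable\<close>.\<close>

inductive_set U :: "'w set" where
  base: "h \<in> H \<Longrightarrow> h \<in> U"
| step: "u \<in> U \<Longrightarrow> i < j \<Longrightarrow> X p a j i u \<in> U"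

text \<open>The bracket of a lowering operator with coefficient in \<open>J\<close> and any other
  lowering operator is again lowering with coefficient in the ideal \<open>J\<close>; therefore the
  induction runs over all roots, parities and coefficients at once.\<close>

lemma J_kills_U: "u \<in> U \<Longrightarrow> i < j \<Longrightarrow> a \<in> J \<Longrightarrow> X p a j i u = 0"
proof (induction u arbitrary: p a i j rule: U.induct)
  case (base h)
  then show ?case by (auto simp: J_def kill_def)
next
  case (step u k l q b)
  have "a * b \<in> J" using step.prems J(1) by (metis algebra_ideal_def mult.commute)
  then have "i = l \<Longrightarrow> X (p + q) (a * b) j k u = 0" "k = j \<Longrightarrow> X (p + q) (a * b) l i u = 0"
    using step by auto
  then show ?case
    using step X_bracket[of p a j i q b l k u] by (auto simp: X_lin)
qed

text \<open>Moving an operator past the outermost lowering operator leaves, besides the swapped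
  product, single operators applied to the shorter vector, where the induction hypothesis holds for
  every operator.\<close>

lemma U_stable: "u \<in> U \<Longrightarrow> X p a i j u \<in> cspan U"
proof (induction u arbitrary: p a i j rule: U.induct)
  case (base h)
  consider "i < j" | "i = j" | "j < i" by fastforce
  then show ?case
    using base by cases (auto simp: H_upper cvec.span_zero intro: cvec.span_base U.intros H_diagonal)
next
  case (step u k l q b)
  have "X q b l k (X p a i j u) \<in> cspan U"
    by (rule clinear_in_subspace[OF X_linear _ _ step.IH])
      (use step.hyps in \<open>simp_all add: cvec.span_base U.step\<close>)
  then show ?case
    using step.IH unfolding X_bracket[of p a i j q b l k u]
    by (intro cvec.span_add cvec.span_diff cvec.span_scale) (auto simp: cvec.span_zero)
qed

text \<open>On \<open>U\<close> a coefficient matters only modulo \<open>J\<close>, so finitely many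
  letters, with coefficients in a finite \<open>B\<close> spanning modulo \<open>J\<close>, generate
  the span of \<open>U\<close> from \<open>H0\<close>.\<close>

lemma U_finite: "\<exists>C. finite C \<and> U \<subseteq> cspan C"
proof -
  obtain B where B: "finite B" "cspan (B \<union> J) = UNIV"
    using J(2) unfolding finite_codimension_def by blast
  obtain H0 where H0: "finite H0" "H0 \<subseteq> H" "H \<subseteq> cspan H0" using H_finite by blast
  define Y where "Y = {(p :: bit, b, j :: 'n, i) | p b j i. b \<in> B \<and> i < j}"
  define T where "T = (\<lambda>(p, b, j, i). X p b j i)"
  have "Y \<subseteq> UNIV \<times> B \<times> UNIV" by (auto simp: Y_def)
  moreover have "finite ((UNIV :: bit set) \<times> B \<times> (UNIV :: ('n \<times> 'n) set))"
    using B(1) finite_bit by (intro finite_cartesian_product finite_UNIV) auto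
  ultimately have Y: "finite Y" by (rule finite_subset)
  have expand: "X p a j i u \<in> cspan ((\<lambda>z. T z u) ` Y)" if "i < j" "u \<in> U" for p a i j u
  proof (rule clinear_in_subspace[of "\<lambda>a. X p a j i u" _ "B \<union> J"])
    show "clinear (\<lambda>a. X p a j i u)" by (simp add: clinear_iff X_add X_scale)
    fix b assume "b \<in> B \<union> J"
    then show "X p b j i u \<in> cspan ((\<lambda>z. T z u) ` Y)"
    proof
      assume "b \<in> B"
      then have "X p b j i u = T (p, b, j, i) u" "(p, b, j, i) \<in> Y" using that by (auto simp: T_def Y_def)
      then show ?thesis by (metis cvec.span_base imageI)
    qed (simp add: J_kills_U that cvec.span_zero)
  qed (use B in auto)
  have "\<exists>n. \<forall>h\<in>H. (T y ^^ n) h = 0" if "y \<in> Y" for y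
  proof -
    obtain p b j i where y: "y = (p, b, j, i)" "i < j" using \<open>y \<in> Y\<close> by (auto simp: Y_def)
    show ?thesis
    proof (cases "p = 0")
      case zero: True
      interpret R: root_operators X H \<phi> I i j by (rule root_operators) fact
      show ?thesis using root_nilpotent[OF y(2)] R.F_power_vanishes y zero by (auto simp: T_def)
    next
      case False
      then have one: "p = 1" by simp
      have "X 1 b j i (X 1 b j i h) = 0" for h
      proof -
        \<comment> \<open>Both factors are odd and \<open>i \<noteq> j\<close>, so the bracket
          relation says that the square equals its own negative.\<close>
        have "(1 + 1) *\<^sub>C X 1 b j i (X 1 b j i h) = 0"
          using X_bracket[of 1 b j i 1 b j i h] less_imp_neq[OF y(2)]
          unfolding scaleC_add_left by (simp add: scaleC_one eq_neg_iff_add_eq_0)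
        then show ?thesis by simp
      qed
      then show ?thesis using y one by (intro exI[of _ 2]) (simp add: T_def numeral_2_eq_2)
    qed
  qed
  then obtain n where n: "\<And>y h. y \<in> Y \<Longrightarrow> h \<in> H \<Longrightarrow> (T y ^^ n y) h = 0" by metis
  \<comment> \<open>The sum of the exponents bounds each \<open>n y\<close> and thus serves all
    letters at once.\<close>
  interpret W: word_operators T Y U H0 "sum n Y"
  proof (rule word_operators.intro)
    show T: "clinear (T y)" for y by (simp add: T_def X_linear split: prod.split)
    show "(T y ^^ sum n Y) h = 0" if "y \<in> Y" "h \<in> H0" for y h
    proof (rule funpow_zero_mono[OF T, where m = "n y"])
      show "n y \<le> sum n Y" using that Y by (intro member_le_sum) auto
    qed (use n that H0 in blast)
    show "T y u \<in> U" if "y \<in> Y" "u \<in> U" for y u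
      using that by (auto simp: T_def Y_def intro: U.step)
    fix y y' u assume y: "y \<in> Y" "y' \<in> Y" and u: "u \<in> U"
    obtain p b j i where 1: "y = (p, b, j, i)" "i < j" using y by (auto simp: Y_def)
    obtain q b' l k where 2: "y' = (q, b', l, k)" "k < l" using y by (auto simp: Y_def)
    \<comment> \<open>The coefficient \<open>b * b'\<close> need not lie in \<open>B\<close>; since
      the bracket acts on a vector of \<open>U\<close>, \<open>expand\<close> rewrites it in the
      letters of \<open>Y\<close>.\<close>
    have "i = l \<Longrightarrow> X (p + q) (b * b') j k u \<in> cspan ((\<lambda>z. T z u) ` Y)"
      "k = j \<Longrightarrow> X (p + q) (b * b') l i u \<in> cspan ((\<lambda>z. T z u) ` Y)"
      using expand u 1 2 by auto
    then have "(if i = l then X (p + q) (b * b') j k u else 0)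
      - koszul p q *\<^sub>C (if k = j then X (p + q) (b * b') l i u else 0) \<in> cspan ((\<lambda>z. T z u) ` Y)"
      by (intro cvec.span_diff cvec.span_scale) (simp_all add: cvec.span_zero)
    then show "\<exists>\<epsilon>. T y (T y' u) - \<epsilon> *\<^sub>C T y' (T y u) \<in> cspan ((\<lambda>z. T z u) ` Y)"
      using X_bracket[of p b j i q b' l k u]
      by (intro exI[of _ "koszul p q"]) (simp add: 1 2 T_def)
  qed (use Y H0 in \<open>auto intro: U.base\<close>)
  obtain C where C: "finite C" "\<And>w h. set w \<subseteq> Y \<Longrightarrow> h \<in> H0 \<Longrightarrow> foldr T w h \<in> cspan C"
    using W.finite_span_words by blast
  define V where "V = cspan {foldr T w h | w h. set w \<subseteq> Y \<and> h \<in> H0}"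
  have "u \<in> V" if "u \<in> U" for u
    using that
  proof (induction u rule: U.induct)
    case (base h)
    have "foldr T [] h \<in> V" if "h \<in> H0" for h
      unfolding V_def using that by (intro cvec.span_base CollectI exI[of _ "[]"] exI[of _ h]) auto
    then have "cspan H0 \<subseteq> V" unfolding V_def by (intro cvec.span_minimal) auto
    then show ?case using base H0 by blast
  next
    case (step u i j p a)
    have "T z u \<in> V" if z: "z \<in> Y" for z
    proof (rule clinear_in_subspace[OF W.T_linear[OF z] _ _ step.IH[unfolded V_def]])
      fix x assume "x \<in> {foldr T w h | w h. set w \<subseteq> Y \<and> h \<in> H0}"
      then obtain w h where "x = foldr T w h" "set w \<subseteq> Y" "h \<in> H0" by blast
      then show "T z x \<in> V"
        unfolding V_def using z by (intro cvec.span_base CollectI exI[of _ "z # w"] exI[of _ h]) auto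
    qed (simp add: V_def)
    then have "cspan ((\<lambda>z. T z u) ` Y) \<subseteq> V" unfolding V_def by (intro cvec.span_minimal) auto
    then show ?case using expand step by blast
  qed
  moreover have "V \<subseteq> cspan C" unfolding V_def using C(2) by (intro cvec.span_minimal) auto
  ultimately show ?thesis using C(1) by blast
qed

theorem finite_stable_subspace:
  obtains V C where "finite C" "V \<subseteq> cspan C" "csubspace V" "H \<subseteq> V"
    "\<And>p a i j v. v \<in> V \<Longrightarrow> X p a i j v \<in> V"
proof -
  obtain C where C: "finite C" "U \<subseteq> cspan C" using U_finite by blast
  show thesis
  proof (rule that[OF C(1)])
    show "cspan U \<subseteq> cspan C" using C by (intro cvec.span_minimal) auto
    show "X p a i j v \<in> cspan U" if "v \<in> cspan U" for p a i j v
      by (rule clinear_in_subspace[OF X_linear _ _ that]) (simp_all add: U_stable)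
  qed (auto intro: cvec.span_base U.base)
qed

end


section \<open>Modules presented by a linear surjection\<close>

text \<open>A linear choice of representatives modulo \<open>N\<close>: a basis of \<open>N\<close>
  is extended to a basis of the whole space, its members are sent to zero and the added vectors are
  fixed.\<close>

lemma exists_projection_along:
  fixes N :: "'a::complex_vector set"
  assumes "csubspace N"
  obtains p where "clinear p" "\<And>t. p t - t \<in> N" "\<And>t. t \<in> N \<Longrightarrow> p t = 0"
proof -
  have pair: "vector_space_pair (scaleC :: complex \<Rightarrow> 'a \<Rightarrow> 'a) (scaleC :: complex \<Rightarrow> 'a \<Rightarrow> 'a)"
    by (rule vector_space_pair.intro[OF cvec.vector_space_axioms cvec.vector_space_axioms])
  obtain B where B: "B \<subseteq> N" "cvec.independent B" "N \<subseteq> cspan B"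
    by (rule cvec.basis_exists[of N]) (rule that)
  obtain C where C: "B \<subseteq> C" "cvec.independent C" "UNIV \<subseteq> cspan C"
    by (rule cvec.maximal_independent_subset_extend[OF subset_UNIV B(2)]) (rule that)
  obtain p where p: "clinear p" "\<forall>x\<in>C. p x = (if x \<in> B then 0 else x)"
    using vector_space_pair.linear_independent_extend[OF pair C(2), of "\<lambda>x. if x \<in> B then 0 else x"] by blast
  interpret p: Vector_Spaces.linear scaleC scaleC p by fact
  have "p t - t \<in> N" for t
  proof (rule clinear_in_subspace[of "\<lambda>t. p t - t" _ C])
    show "clinear (\<lambda>t. p t - t)" by (simp add: clinear_iff p.add p.scale cvec.scale_right_diff_distrib)
    show "p x - x \<in> N" if "x \<in> C" for x
      using p(2) that B(1) assms cvec.subspace_neg cvec.subspace_0 by auto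
  qed (use C(3) assms in auto)
  moreover have "p t = 0" if "t \<in> N" for t
  proof (rule p.eq_0_on_span)
    show "t \<in> cspan B" using that B(3) by blast
    show "p x = 0" if "x \<in> B" for x using p(2) that C(1) by auto
  qed
  ultimately show thesis using that p(1) by blast
qed

text \<open>The module records carry no axioms. A surjection from a vector space type that respects
  all operations transports the laws to the record, and \<open>\<alpha>\<close> lifts the action to
  that space.\<close>

definition presents :: "('l, 'v, 'm) lie_module_scheme \<Rightarrow> ('t::complex_vector \<Rightarrow> 'v) \<Rightarrow> ('l \<Rightarrow> 't \<Rightarrow> 't) \<Rightarrow> bool"
  where "presents M q \<alpha> \<longleftrightarrow> carrier M = range q \<and> q 0 = \<zero>\<^bsub>M\<^esub> \<and>
    (\<forall>s t. q (s + t) = q s \<oplus>\<^bsub>M\<^esub> q t) \<and> (\<forall>c t. q (c *\<^sub>C t) = c \<odot>\<^bsub>M\<^esub> q t) \<and>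
    (\<forall>x t. q (\<alpha> x t) = act M x (q t))"

locale presented_module =
  fixes M :: "('l, 'v) lie_module" and q :: "'t::complex_vector \<Rightarrow> 'v" and \<alpha> :: "'l \<Rightarrow> 't \<Rightarrow> 't"
  assumes presents: "presents M q \<alpha>"
    and \<alpha>_linear: "clinear (\<alpha> x)"
begin

lemma carrier_eq: "carrier M = range q"
  and q_zero: "q 0 = \<zero>\<^bsub>M\<^esub>"
  and q_add: "q (s + t) = q s \<oplus>\<^bsub>M\<^esub> q t"
  and q_scale: "q (c *\<^sub>C t) = c \<odot>\<^bsub>M\<^esub> q t"
  and q_act: "q (\<alpha> x t) = act M x (q t)"
  using presents by (simp_all add: presents_def)

lemma abelian: "abelian_group M"
proof (rule abelian_groupI)
  fix x assume "x \<in> carrier M"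
  then obtain t where "x = q t" by (auto simp: carrier_eq)
  then show "\<exists>y\<in>carrier M. y \<oplus>\<^bsub>M\<^esub> x = \<zero>\<^bsub>M\<^esub>"
    by (intro bexI[of _ "q (- t)"]) (auto simp: carrier_eq simp flip: q_add q_zero)
qed (auto simp: carrier_eq ac_simps simp flip: q_add q_zero)

sublocale abelian_group M by (rule abelian)

lemma q_sum: "finite B \<Longrightarrow> q (sum f B) = (\<Oplus>\<^bsub>M\<^esub>b\<in>B. q (f b))"
proof (induction rule: finite_induct)
  case (insert b B)
  have "(\<lambda>b. q (f b)) \<in> B \<rightarrow> carrier M" "q (f b) \<in> carrier M" by (auto simp: carrier_eq)
  then show ?case using insert by (simp add: q_add)
qed (simp add: q_zero)

lemma finite_dimensionalI:
  assumes C: "finite C" and span: "\<And>t. \<exists>s\<in>cspan C. q t = q s"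
  shows "finite_dimensional_module M"
proof -
  define B where "B = q ` C"
  \<comment> \<open>\<open>q\<close> may identify elements of \<open>C\<close>, so one preimage is
    fixed for each element of \<open>B\<close>.\<close>
  define r where "r = inv_into C q"
  have r: "q (r b) = b" if "b \<in> B" for b using that by (simp add: B_def r_def f_inv_into_f)
  have B: "finite B" "B \<subseteq> carrier M" using C by (auto simp: B_def carrier_eq)
  have comb: "\<exists>c. q s = q (\<Sum>b\<in>B. c b *\<^sub>C r b)" if "s \<in> cspan C" for s
    using that
  proof (induction s rule: cvec.span_induct_alt)
    case base
    show ?case by (intro exI[of _ "\<lambda>_. 0"]) simp
  next
    case (step k x y)
    then obtain c where c: "q y = q (\<Sum>b\<in>B. c b *\<^sub>C r b)" by blast
    have x: "q x \<in> B" using step by (simp add: B_def)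
    have "(\<Sum>b\<in>B. ((if b = q x then k else 0) + c b) *\<^sub>C r b) =
        k *\<^sub>C r (q x) + (\<Sum>b\<in>B. c b *\<^sub>C r b)"
      using x B(1) by (simp add: scaleC_add_left sum.distrib if_distrib[of "\<lambda>k. k *\<^sub>C _"] cong: if_cong)
    then have "q (k *\<^sub>C x + y) = q (\<Sum>b\<in>B. ((if b = q x then k else 0) + c b) *\<^sub>C r b)"
      using c r[OF x] by (simp add: q_add q_scale)
    then show ?case by (intro exI[of _ "\<lambda>b. (if b = q x then k else 0) + c b"])
  qed
  have "\<exists>c. v = (\<Oplus>\<^bsub>M\<^esub>b\<in>B. c b \<odot>\<^bsub>M\<^esub> b)" if "v \<in> carrier M" for v
  proof -
    obtain t where "v = q t" using \<open>v \<in> carrier M\<close> by (auto simp: carrier_eq)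
    then obtain c where "v = q (\<Sum>b\<in>B. c b *\<^sub>C r b)" using span comb by metis
    then have "v = (\<Oplus>\<^bsub>M\<^esub>b\<in>B. c b \<odot>\<^bsub>M\<^esub> q (r b))" by (simp add: q_sum[OF B(1)] q_scale)
    also have "\<dots> = (\<Oplus>\<^bsub>M\<^esub>b\<in>B. c b \<odot>\<^bsub>M\<^esub> b)"
      using r B(2) by (intro finsum_cong') (auto simp: carrier_eq simp flip: q_scale)
    finally show ?thesis by blast
  qed
  then show ?thesis unfolding finite_dimensional_module_def using B by blast
qed

end

locale presented_submodule = presented_module +
  fixes N
  assumes N_carrier: "N \<subseteq> carrier M"
    and N_zero: "q 0 \<in> N"
    and N_add: "q s \<in> N \<Longrightarrow> q t \<in> N \<Longrightarrow> q (s + t) \<in> N"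
    and N_scale: "q t \<in> N \<Longrightarrow> q (c *\<^sub>C t) \<in> N"
    and N_act: "q t \<in> N \<Longrightarrow> q (\<alpha> x t) \<in> N"
begin

lemma N_diff: "q s \<in> N \<Longrightarrow> q t \<in> N \<Longrightarrow> q (s - t) \<in> N"
  using N_add[of s "(-1) *\<^sub>C t"] N_scale[of t "-1"] by (simp add: scaleC_one)

lemma coset_eq: "N +>\<^bsub>M\<^esub> q t = {q s | s. q (s - t) \<in> N}"
proof (intro Set.set_eqI iffI)
  fix y assume "y \<in> N +>\<^bsub>M\<^esub> q t"
  then obtain v where "v \<in> N" "y = v \<oplus>\<^bsub>M\<^esub> q t" by (auto simp: a_r_coset_def')
  moreover from this obtain n where "v = q n" using N_carrier by (auto simp: carrier_eq)
  ultimately show "y \<in> {q s | s. q (s - t) \<in> N}"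
    by (intro CollectI exI[of _ "n + t"]) (simp add: q_add)
next
  fix y assume "y \<in> {q s | s. q (s - t) \<in> N}"
  then obtain s where "y = q (s - t) \<oplus>\<^bsub>M\<^esub> q t" "q (s - t) \<in> N" by (auto simp flip: q_add)
  then show "y \<in> N +>\<^bsub>M\<^esub> q t" by (auto simp: a_r_coset_def')
qed

lemma coset_cong: assumes "q (s - t) \<in> N" shows "N +>\<^bsub>M\<^esub> q s = N +>\<^bsub>M\<^esub> q t"
proof -
  have "q (r - s) \<in> N \<longleftrightarrow> q (r - t) \<in> N" for r
  proof -
    have "r - s + (s - t) = r - t" "r - t - (s - t) = r - s" by simp_all
    then show ?thesis using N_add[OF _ assms, of "r - s"] N_diff[OF _ assms, of "r - t"] by metis
  qed
  then show ?thesis by (simp add: coset_eq)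
qed

text \<open>The operations of \<open>quotient_module\<close> are unions over all representatives of
  a coset; compatibility with \<open>N\<close> makes the united cosets equal.\<close>

lemma coset_union:
  assumes "\<And>s. q (s - t) \<in> N \<Longrightarrow> q (f s - f t) \<in> N" "\<And>s. g (q s) = q (f s)"
  shows "(\<Union>v\<in>N +>\<^bsub>M\<^esub> q t. N +>\<^bsub>M\<^esub> g v) = N +>\<^bsub>M\<^esub> q (f t)"
proof -
  have "N +>\<^bsub>M\<^esub> g v = N +>\<^bsub>M\<^esub> q (f t)" if "v \<in> N +>\<^bsub>M\<^esub> q t" for v
  proof -
    obtain s where "v = q s" "q (s - t) \<in> N" using \<open>v \<in> N +>\<^bsub>M\<^esub> q t\<close> by (auto simp: coset_eq)
    then show ?thesis using assms coset_cong by metis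
  qed
  moreover have "q t \<in> N +>\<^bsub>M\<^esub> q t" using N_zero by (auto simp: coset_eq)
  ultimately show ?thesis by blast
qed

text \<open>The lift \<open>\<alpha>\<close> is unchanged, so the construction can be iterated: once
  for the balancing relations and once for the relations of the local Weyl module.\<close>

lemma presents_quotient: "presents (quotient_module M N) (\<lambda>t. N +>\<^bsub>M\<^esub> q t) \<alpha>"
  unfolding presents_def
proof (intro conjI allI)
  show "carrier (quotient_module M N) = range (\<lambda>t. N +>\<^bsub>M\<^esub> q t)"
    by (auto simp: quotient_module_def A_RCOSETS_def' carrier_eq)
  have "N = {q s | s. q s \<in> N}" using N_carrier by (auto simp: carrier_eq)
  then show "N +>\<^bsub>M\<^esub> q 0 = \<zero>\<^bsub>quotient_module M N\<^esub>"
    by (simp add: quotient_module_def coset_eq)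
  show "N +>\<^bsub>M\<^esub> q (s + t) = (N +>\<^bsub>M\<^esub> q s) \<oplus>\<^bsub>quotient_module M N\<^esub> (N +>\<^bsub>M\<^esub> q t)" for s t
  proof -
    have "(N +>\<^bsub>M\<^esub> q s) <+>\<^bsub>M\<^esub> (N +>\<^bsub>M\<^esub> q t) = N +>\<^bsub>M\<^esub> q (s + t)"
    proof (intro Set.set_eqI iffI)
      fix y assume "y \<in> (N +>\<^bsub>M\<^esub> q s) <+>\<^bsub>M\<^esub> (N +>\<^bsub>M\<^esub> q t)"
      then obtain s' t' where "y = q (s' + t')" "q (s' - s) \<in> N" "q (t' - t) \<in> N"
        by (auto simp: set_add_def' coset_eq q_add)
      then show "y \<in> N +>\<^bsub>M\<^esub> q (s + t)"
        using N_add[of "s' - s" "t' - t"] by (auto simp: coset_eq algebra_simps)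
    next
      fix y assume "y \<in> N +>\<^bsub>M\<^esub> q (s + t)"
      then obtain r where r: "y = q r" "q (r - (s + t)) \<in> N" by (auto simp: coset_eq)
      have "y = q (r - t) \<oplus>\<^bsub>M\<^esub> q t" by (simp add: r flip: q_add)
      moreover have "q (r - t) \<in> N +>\<^bsub>M\<^esub> q s" using r(2) by (auto simp: coset_eq algebra_simps)
      moreover have "q t \<in> N +>\<^bsub>M\<^esub> q t" using N_zero by (auto simp: coset_eq)
      ultimately show "y \<in> (N +>\<^bsub>M\<^esub> q s) <+>\<^bsub>M\<^esub> (N +>\<^bsub>M\<^esub> q t)" by (auto simp: set_add_def')
    qed
    then show ?thesis by (simp add: quotient_module_def)
  qed
  show "N +>\<^bsub>M\<^esub> q (c *\<^sub>C t) = c \<odot>\<^bsub>quotient_module M N\<^esub> (N +>\<^bsub>M\<^esub> q t)" for c t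
  proof -
    have "(\<Union>v\<in>N +>\<^bsub>M\<^esub> q t. N +>\<^bsub>M\<^esub> (c \<odot>\<^bsub>M\<^esub> v)) = N +>\<^bsub>M\<^esub> q (c *\<^sub>C t)"
      by (rule coset_union[where f = "scaleC c"])
        (use N_scale in \<open>simp_all add: q_scale flip: cvec.scale_right_diff_distrib\<close>)
    then show ?thesis by (simp add: quotient_module_def)
  qed
  show "N +>\<^bsub>M\<^esub> q (\<alpha> x t) = act (quotient_module M N) x (N +>\<^bsub>M\<^esub> q t)" for x t
  proof -
    interpret \<alpha>: Vector_Spaces.linear scaleC scaleC "\<alpha> x" by (rule \<alpha>_linear)
    have "(\<Union>v\<in>N +>\<^bsub>M\<^esub> q t. N +>\<^bsub>M\<^esub> act M x v) = N +>\<^bsub>M\<^esub> q (\<alpha> x t)"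
    proof (rule coset_union[where f = "\<alpha> x"])
      show "q (\<alpha> x s - \<alpha> x t) \<in> N" if "q (s - t) \<in> N" for s
        using N_act[OF that, of x] by (simp add: \<alpha>.diff)
    qed (simp add: q_act)
    then show ?thesis by (simp add: quotient_module_def)
  qed
qed

end

context presented_module begin

text \<open>Ensures that the intersection defining \<open>generated_submodule\<close> runs over a
  nonempty family; over the empty family it would be the whole type.\<close>

lemma graded_submodule_carrier:
  assumes "\<And>t. \<exists>y z. q y \<in> part M 0 \<and> q z \<in> part M 1 \<and> t = y + z"
  shows "graded_submodule M (carrier M)"
  unfolding graded_submodule_def
proof (intro conjI allI ballI)
  show "submodule (carrier M) complex_ring M"
  proof (intro submodule.intro submodule_axioms.intro)
    show "subgroup (carrier M) (add_monoid M)"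
      using group.subgroup_self[OF a_group] by simp
  qed (auto simp: carrier_eq simp flip: q_scale)
  fix v assume "v \<in> carrier M"
  then obtain t where t: "v = q t" by (auto simp: carrier_eq)
  then show "act M x v \<in> carrier M" for x by (simp add: carrier_eq flip: q_act)
  obtain y z where "q y \<in> part M 0" "q z \<in> part M 1" "t = y + z" using assms by blast
  then show "\<exists>y\<in>carrier M \<inter> part M 0. \<exists>z\<in>carrier M \<inter> part M 1. v = y \<oplus>\<^bsub>M\<^esub> z"
    by (intro bexI[of _ "q y"] bexI[of _ "q z"]) (auto simp: t q_add carrier_eq)
qed

lemma presented_generated_submodule:
  assumes graded: "graded_submodule M (carrier M)" and S: "S \<subseteq> carrier M"
  shows "presented_submodule M q \<alpha> (generated_submodule M S)"
proof
  let ?G = "{N. graded_submodule M N \<and> S \<subseteq> N}"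
  have memI: "v \<in> generated_submodule M S" if "\<And>N. N \<in> ?G \<Longrightarrow> v \<in> N" for v
    using that by (simp add: generated_submodule_def)
  have memD: "v \<in> N" if "v \<in> generated_submodule M S" "N \<in> ?G" for v N
    using that by (auto simp: generated_submodule_def)
  have sub: "submodule N complex_ring M" if "N \<in> ?G" for N
    using that by (simp add: graded_submodule_def)
  have grp: "subgroup N (add_monoid M)" if "N \<in> ?G" for N
    using sub[OF that] by (simp add: submodule_def)
  show "generated_submodule M S \<subseteq> carrier M"
    using memD[of _ "carrier M"] graded S by blast
  show "q 0 \<in> generated_submodule M S"
  proof (rule memI)
    show "q 0 \<in> N" if "N \<in> ?G" for N
      using subgroup.one_closed[OF grp[OF that]] by (simp add: q_zero)
  qed
  show "q (s + t) \<in> generated_submodule M S"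
    if st: "q s \<in> generated_submodule M S" "q t \<in> generated_submodule M S" for s t
  proof (rule memI)
    show "q (s + t) \<in> N" if N: "N \<in> ?G" for N
      using subgroup.m_closed[OF grp[OF N] memD[OF st(1) N] memD[OF st(2) N]] by (simp add: q_add)
  qed
  show "q (c *\<^sub>C t) \<in> generated_submodule M S" if t: "q t \<in> generated_submodule M S" for c t
  proof (rule memI)
    show "q (c *\<^sub>C t) \<in> N" if N: "N \<in> ?G" for N
      using submodule.smult_closed[OF sub[OF N] _ memD[OF t N], of c]
      by (simp add: q_scale complex_ring_def)
  qed
  show "q (\<alpha> x t) \<in> generated_submodule M S" if t: "q t \<in> generated_submodule M S" for x t
  proof (rule memI)
    show "q (\<alpha> x t) \<in> N" if N: "N \<in> ?G" for N
      using memD[OF t N] N by (simp add: q_act graded_submodule_def)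
  qed
qed

end


section \<open>The induced module\<close>

lemma tens_zero: "x \<otimes>\<^sub>C 0 = 0" "0 \<otimes>\<^sub>C y = 0"
  using tens_scaleC_right[of x 0 0] tens_scaleC_left[of 0 0 y] by simp_all

lemma clinear_tens: "clinear (\<lambda>u. u \<otimes>\<^sub>C v)"
  by (simp add: clinear_iff tens_add_left tens_scaleC_left)

lemma uea_class_linear: "clinear uea_class"
  by (simp add: clinear_iff uea_class_def plus_uea.abs_eq scaleC_uea.abs_eq)

lemma uea_class_eqI: "p - q \<in> uea_relations \<Longrightarrow> uea_class p = uea_class q"
  unfolding uea_class_def uea.abs_eq_iff uea_ideal_generators_def
  by (rule cvec.span_base) (metis (mono_tags, lifting) mem_Collect_eq mult.left_neutral mult.right_neutral)

lemma uea_embed_linear: "clinear uea_embed"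
proof (rule clinearI)
  interpret C: Vector_Spaces.linear scaleC scaleC uea_class by (rule uea_class_linear)
  fix x y :: 'a and c
  have "uea_class (letter (x + y)) = uea_class (letter x + letter y)"
    by (rule uea_class_eqI) (auto simp: uea_relations_def)
  then show "uea_embed (x + y) = uea_embed x + uea_embed y" by (simp add: uea_embed_def C.add)
  have "uea_class (letter (c *\<^sub>C x)) = uea_class (c *\<^sub>C letter x)"
    by (rule uea_class_eqI) (auto simp: uea_relations_def)
  then show "uea_embed (c *\<^sub>C x) = c *\<^sub>C uea_embed x" by (simp add: uea_embed_def C.scale)
qed

lemma uea_embed_bracket:
  assumes "x \<in> grade i" "y \<in> grade j"
  shows "uea_embed x * uea_embed y = koszul i j *\<^sub>C (uea_embed y * uea_embed x) + uea_embed (lie_bracket x y)"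
proof -
  interpret C: Vector_Spaces.linear scaleC scaleC uea_class by (rule uea_class_linear)
  have mult: "uea_class (p * q) = uea_class p * uea_class q" for p q :: "'a word \<Rightarrow>\<^sub>0 complex"
    by (simp add: uea_class_def times_uea.abs_eq)
  have "letter x * letter y - (koszul i j *\<^sub>C (letter y * letter x) + letter (lie_bracket x y)) \<in> uea_relations"
    unfolding uea_relations_def diff_diff_eq[symmetric] using assms by blast
  from uea_class_eqI[OF this] show ?thesis by (simp add: mult uea_embed_def C.add C.scale)
qed

lemma uea_class_Nil: "uea_class (free_vec (Word [])) = 1"
  by (simp add: uea_class_def one_uea.abs_eq free_vec_def flip: single_one zero_word_def)

lemma uea_class_Cons: "uea_class (free_vec (Word (x # xs))) = uea_embed x * uea_class (free_vec (Word xs))"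
  by (simp add: uea_embed_def uea_class_def times_uea.abs_eq letter_def free_vec_def mult_single plus_word_def)

lemma uea_span_words: "u \<in> cspan (range (\<lambda>xs. uea_class (free_vec (Word xs))))"
proof (induction u rule: uea.abs_induct)
  case (1 p)
  interpret C: Vector_Spaces.linear scaleC scaleC uea_class by (rule uea_class_linear)
  have "p = (\<Sum>k\<in>Poly_Mapping.keys p. Poly_Mapping.lookup p k *\<^sub>C free_vec k)"
    using poly_mapping_sum_single[of p] by (simp add: free_vec_def scaleC_single scaleC_complex_def)
  then have "uea_class p = (\<Sum>k\<in>Poly_Mapping.keys p. Poly_Mapping.lookup p k *\<^sub>C uea_class (free_vec k))"
    by (metis (no_types, lifting) C.scale C.sum sum.cong)
  moreover have "uea_class (free_vec k) \<in> range (\<lambda>xs. uea_class (free_vec (Word xs)))" for k :: "'a word"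
    by (cases k) auto
  ultimately have "uea_class p \<in> cspan (range (\<lambda>xs. uea_class (free_vec (Word xs))))"
    by (simp add: cvec.span_sum cvec.span_scale cvec.span_base)
  then show ?case by (simp add: uea_class_def)
qed

text \<open>Splitting every letter into its homogeneous parts turns a word into a sum of homogeneous
  words. This lets the full carrier count as a graded submodule.\<close>

lemma uea_grade_decomp: "\<exists>y\<in>uea_grade 0. \<exists>z\<in>uea_grade 1. u = y + z"
proof -
  define W where "W i = {uea_class (free_vec w) | (w :: 'a word) ps.
    list_all2 (\<lambda>x p. x \<in> grade p) (letters w) ps \<and> sum_list ps = i}" for i
  have step: "uea_embed x * y \<in> cspan (W 0 \<union> W 1)" if "x \<in> grade p" "y \<in> cspan (W 0 \<union> W 1)" for x p y
    using that(2)
  proof (rule clinear_in_subspace[rotated 3, OF _ clinear_mult_left])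
    fix y assume "y \<in> W 0 \<union> W 1"
    then obtain w ps where y: "y = uea_class (free_vec w)" "list_all2 (\<lambda>x p. x \<in> grade p) (letters w) ps"
      by (auto simp: W_def)
    have "uea_embed x * y = uea_class (free_vec (Word (x # letters w)))"
      by (simp add: uea_class_Cons y(1))
    moreover have "list_all2 (\<lambda>x p. x \<in> grade p) (letters (Word (x # letters w))) (p # ps)"
      using y(2) that(1) by simp
    ultimately have "uea_embed x * y \<in> W (sum_list (p # ps))"
      unfolding W_def by blast
    then have "uea_embed x * y \<in> W 0 \<union> W 1" by (cases "sum_list (p # ps) = 0") auto
    then show "uea_embed x * y \<in> cspan (W 0 \<union> W 1)" by (rule cvec.span_base)
  qed simp
  have "uea_class (free_vec (Word xs)) \<in> cspan (W 0 \<union> W 1)" for xs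
  proof (induction xs)
    case Nil
    have "uea_class (free_vec (Word [])) \<in> W 0"
      unfolding W_def by (intro CollectI exI[of _ "Word []"] exI[of _ "[]"]) simp
    then show ?case by (intro cvec.span_base) auto
  next
    case (Cons x xs)
    interpret E: Vector_Spaces.linear scaleC scaleC "uea_embed :: 'a \<Rightarrow> 'a uea" by (rule uea_embed_linear)
    obtain y z where "y \<in> grade 0" "z \<in> grade 1" "x = y + z" using grade_decomp by blast
    then show ?case
      using step Cons by (auto simp: uea_class_Cons E.add distrib_right intro!: cvec.span_add)
  qed
  then have "u \<in> cspan (W 0 \<union> W 1)"
    using uea_span_words[of u] cvec.span_minimal[OF _ cvec.subspace_span] by (meson image_subsetI in_mono)
  then show ?thesis unfolding cvec.span_Un by (auto simp: W_def uea_grade_def)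
qed

definition uea_act :: "'l::lie_superalgebra \<Rightarrow> ('l uea, 'v::super_vector) tensor \<Rightarrow> ('l uea, 'v) tensor"
  where "uea_act x = tensor_lift (\<lambda>u v. (uea_embed x * u) \<otimes>\<^sub>C v)"

lemma uea_act_bilinear: "cbilinear (\<lambda>u v. (uea_embed x * u) \<otimes>\<^sub>C v)"
  by (simp add: cbilinear_def clinear_iff distrib_left mult_scaleC_right
      tens_add_right tens_scaleC_right tens_add_left tens_scaleC_left)

lemma uea_act_tens: "uea_act x (u \<otimes>\<^sub>C v) = (uea_embed x * u) \<otimes>\<^sub>C v"
  unfolding uea_act_def by (rule tensor_lift_tens[OF uea_act_bilinear])

lemma uea_act_linear: "clinear (uea_act x)"
  unfolding uea_act_def by (rule clinear_tensor_lift[OF uea_act_bilinear])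

lemma uea_act_add_right: "uea_act x (s + t) = uea_act x s + uea_act x t"
  and uea_act_scale_right: "uea_act x (c *\<^sub>C t) = c *\<^sub>C uea_act x t"
  using uea_act_linear unfolding clinear_iff by blast+

lemma uea_act_linear_left: "clinear (\<lambda>x. uea_act x t)"
proof -
  interpret E: Vector_Spaces.linear scaleC scaleC "uea_embed :: 'a \<Rightarrow> 'a uea" by (rule uea_embed_linear)
  show ?thesis
    unfolding clinear_iff
  proof (induction t rule: tensor_induct)
    case (tens u v)
    show ?case
      by (simp add: uea_act_tens E.add E.scale distrib_right mult_scaleC_left tens_add_left tens_scaleC_left)
  next
    case (add s t)
    then show ?case by (simp add: uea_act_add_right scaleC_add_right)
  qed
qed

lemma uea_act_bracket:
  assumes "x \<in> grade i" "y \<in> grade j"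
  shows "uea_act x (uea_act y t) = koszul i j *\<^sub>C uea_act y (uea_act x t) + uea_act (lie_bracket x y) t"
proof (induction t rule: tensor_induct)
  case (tens u v)
  show ?case
    using uea_embed_bracket[OF assms]
    by (simp add: uea_act_tens mult.assoc[symmetric] distrib_right mult_scaleC_left tens_add_left tens_scaleC_left)
next
  case (add s t)
  then show ?case by (simp add: uea_act_add_right scaleC_add_right)
qed

lemma uea_act_power: "(uea_act x ^^ k) (u \<otimes>\<^sub>C v) = (uea_embed x ^ k * u) \<otimes>\<^sub>C v"
  by (induction k) (simp_all add: uea_act_tens mult.assoc)

lemma presents_uea_tensor: "presents uea_tensor (\<lambda>t. t) uea_act"
  by (simp add: presents_def uea_tensor_def uea_act_def)

lemma csubspace_part: "csubspace (part uea_tensor i)"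
  by (simp add: uea_tensor_def)

lemma uea_tensor_decomp:
  "\<exists>y\<in>part uea_tensor 0. \<exists>z\<in>part uea_tensor 1. t = y + z"
proof (induction t rule: tensor_induct)
  case (tens u v)
  obtain u0 u1 where u: "u0 \<in> uea_grade 0" "u1 \<in> uea_grade 1" "u = u0 + u1"
    using uea_grade_decomp by blast
  obtain v0 v1 where v: "v0 \<in> grade 0" "v1 \<in> grade 1" "v = v0 + v1"
    using grade_decomp by blast
  have part: "a \<otimes>\<^sub>C b \<in> part uea_tensor i" if "a \<in> uea_grade j" "b \<in> grade k" "j + k = i"
    for a :: "'a uea" and b :: 'b and i j k
  proof -
    have "a \<otimes>\<^sub>C b \<in> {u \<otimes>\<^sub>C v | u v j k. u \<in> uea_grade j \<and> v \<in> grade k \<and> j + k = i}"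
      using that by blast
    then show ?thesis by (simp add: uea_tensor_def cvec.span_base)
  qed
  have "u0 \<otimes>\<^sub>C v0 + u1 \<otimes>\<^sub>C v1 \<in> part uea_tensor 0" "u0 \<otimes>\<^sub>C v1 + u1 \<otimes>\<^sub>C v0 \<in> part uea_tensor 1"
    by (rule cvec.subspace_add[OF csubspace_part]; rule part[OF u(1) v(1)] part[OF u(2) v(2)] part[OF u(1) v(2)] part[OF u(2) v(1)]; simp)+
  moreover have "u \<otimes>\<^sub>C v = (u0 \<otimes>\<^sub>C v0 + u1 \<otimes>\<^sub>C v1) + (u0 \<otimes>\<^sub>C v1 + u1 \<otimes>\<^sub>C v0)"
    by (simp add: u v tens_add_left tens_add_right)
  ultimately show ?case by blast
next
  case (add s t)
  then obtain y z y' z' where "y \<in> part uea_tensor 0" "z \<in> part uea_tensor 1" "s = y + z"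
    "y' \<in> part uea_tensor 0" "z' \<in> part uea_tensor 1" "t = y' + z'" by blast
  moreover from this have "y + y' \<in> part uea_tensor 0" "z + z' \<in> part uea_tensor 1"
    by (simp_all add: cvec.subspace_add[OF csubspace_part])
  ultimately show ?case by (metis add.assoc add.left_commute)
qed

text \<open>The action multiplies \<open>u\<close> from the left, whereas balancing takes place on
  its right; generators therefore go to generators.\<close>

lemma balancing_presented: "presented_submodule uea_tensor (\<lambda>t. t) uea_act (balancing_relations S \<rho>)"
proof (intro presented_submodule.intro presented_module.intro presented_submodule_axioms.intro)
  show "uea_act x t \<in> balancing_relations S \<rho>" if "t \<in> balancing_relations S \<rho>" for x t
    using that unfolding balancing_relations_def
  proof (rule clinear_in_subspace[rotated 3, OF _ uea_act_linear])
    fix t assume "t \<in> {(u * uea_class p) \<otimes>\<^sub>C v - u \<otimes>\<^sub>C free_action \<rho> p v | u p v.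
      \<forall>w\<in>Poly_Mapping.keys p. set (letters w) \<subseteq> S}"
    then obtain u p v where t: "t = (u * uea_class p) \<otimes>\<^sub>C v - u \<otimes>\<^sub>C free_action \<rho> p v"
      "\<forall>w\<in>Poly_Mapping.keys p. set (letters w) \<subseteq> S" by blast
    interpret A: Vector_Spaces.linear scaleC scaleC "uea_act x" by (rule uea_act_linear)
    have "uea_act x t = ((uea_embed x * u) * uea_class p) \<otimes>\<^sub>C v - (uea_embed x * u) \<otimes>\<^sub>C free_action \<rho> p v"
      by (simp add: t A.diff uea_act_tens mult.assoc)
    then show "uea_act x t \<in> cspan {(u * uea_class p) \<otimes>\<^sub>C v - u \<otimes>\<^sub>C free_action \<rho> p v | u p v.
      \<forall>w\<in>Poly_Mapping.keys p. set (letters w) \<subseteq> S}"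
      using t(2) by (blast intro: cvec.span_base)
  qed simp
qed (use presents_uea_tensor uea_act_linear in
    \<open>auto simp: uea_tensor_def balancing_relations_def cvec.span_zero intro: cvec.span_add cvec.span_scale\<close>)

section \<open>Matrix units of q(n) in both parities\<close>

lemma queer_block_diff: "queer_block A B - queer_block A' B' = queer_block (A - A') (B - B')"
  by (simp only: diff_conv_add_uminus queer_ops)

lemma queer_block_cartan: "queer_block A B \<in> cartan \<longleftrightarrow> diagonal A \<and> diagonal B"
  by (auto simp: cartan_def queer_block_eq_iff)

lemma queer_block_n_plus: "queer_block A B \<in> n_plus \<longleftrightarrow> strictly_upper A \<and> strictly_upper B"
  by (auto simp: n_plus_def queer_block_eq_iff)

definition queer_unit :: "bit \<Rightarrow> 'n \<Rightarrow> 'n \<Rightarrow> 'n::finite queer"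
  where "queer_unit p i j = (if p = 0 then queer_block (matrix_unit i j) 0 else queer_block 0 (matrix_unit i j))"

lemma queer_unit_grade: "queer_unit p i j \<in> grade p"
  by (simp add: queer_unit_def queer_block_grade)

lemma matrix_unit_mult: "matrix_unit i j ** matrix_unit k l = (if j = k then matrix_unit i l else 0)"
  by (auto simp: vec_eq_iff matrix_matrix_mult_def matrix_unit_def if_distrib[of "\<lambda>x. _ * x"]
      if_distrib[of "\<lambda>x. x * _"] cong: if_cong)

lemma queer_unit_bracket: "lie_bracket (queer_unit p i j) (queer_unit q k l) =
  (if j = k then queer_unit (p + q) i l else 0) + (- koszul p q) *\<^sub>C (if l = i then queer_unit (p + q) k j else 0)"
  by (cases "p = 0"; cases "q = 0")
    (auto simp: queer_unit_def queer_ops queer_block_diff matrix_simps matrix_unit_mult queer_block_eq_iff scaleC_one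
      cvec.scale_minus_left)

lemma queer_unit_in_span_units: "queer_unit p i j \<in> cspan (range (\<lambda>(p, i, j). queer_unit p i j))"
  by (rule cvec.span_base) (rule image_eqI[of _ _ "(p, i, j)"], simp_all)

lemma queer_span_units: "(g :: 'n::finite queer) \<in> cspan (range (\<lambda>(p, i, j). queer_unit p i j))"
proof (cases g)
  case (1 A B)
  have M: "M \<in> cspan (range (\<lambda>(i, j). matrix_unit i j))" for M :: "complex^'n^'n"
  proof -
    have "M = (\<Sum>i\<in>UNIV. \<Sum>j\<in>UNIV. M $ i $ j *\<^sub>C matrix_unit i j)"
    proof -
      have "(\<Sum>x\<in>UNIV. \<Sum>y\<in>UNIV. if i = x \<and> j = y then M $ x $ y else 0) = M $ i $ j" for i j
      proof -
        have "(\<Sum>y\<in>UNIV. if i = x \<and> j = y then M $ x $ y else 0) = (if i = x then M $ x $ j else 0)" for x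
          by (cases "i = x") simp_all
        then show ?thesis by simp
      qed
      then show ?thesis
        by (simp add: vec_eq_iff matrix_unit_def scaleC_vec_def scaleC_complex_def
            if_distrib[of "\<lambda>x. _ * x"] if_distrib[of "\<lambda>x. x $ _"] cong: if_cong)
    qed
    moreover have "\<dots> \<in> cspan (range (\<lambda>(i, j). matrix_unit i j))"
      by (intro cvec.span_sum cvec.span_scale cvec.span_base) auto
    ultimately show ?thesis by simp
  qed
  let ?S = "cspan (range (\<lambda>(p, i, j). queer_unit p i j)) :: 'n queer set"
  have "queer_block A 0 \<in> ?S"
  proof (rule clinear_in_subspace[where f = "\<lambda>A. queer_block A 0", OF _ _ _ M])
    show "clinear (\<lambda>A. queer_block A 0)" by (simp add: clinear_iff queer_ops)
    fix x :: "complex^'n^'n" assume "x \<in> range (\<lambda>(i, j). matrix_unit i j)"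
    then obtain i j where "queer_block x 0 = queer_unit 0 i j" by (auto simp: queer_unit_def)
    then show "queer_block x 0 \<in> ?S" using queer_unit_in_span_units by simp
  qed simp
  moreover have "queer_block 0 B \<in> ?S"
  proof (rule clinear_in_subspace[where f = "\<lambda>B. queer_block 0 B", OF _ _ _ M])
    show "clinear (\<lambda>B. queer_block 0 B)" by (simp add: clinear_iff queer_ops)
    fix x :: "complex^'n^'n" assume "x \<in> range (\<lambda>(i, j). matrix_unit i j)"
    then obtain i j where "queer_block 0 x = queer_unit 1 i j" by (auto simp: queer_unit_def)
    then show "queer_block 0 x \<in> ?S" using queer_unit_in_span_units by simp
  qed simp
  moreover have "g = queer_block A 0 + queer_block 0 B" by (simp add: 1 queer_ops)
  ultimately show ?thesis by (simp add: cvec.span_add)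
qed

lemma queer_unit_cartan: "queer_unit p i i \<in> cartan"
  by (auto simp: queer_unit_def queer_block_cartan diagonal_def matrix_unit_def)

lemma queer_unit_cartan_even: "queer_unit 0 i i \<in> cartan_even"
  using queer_unit_cartan queer_unit_grade by (auto simp: cartan_even_def)

lemma queer_unit_n_plus: "i < j \<Longrightarrow> queer_unit p i j \<in> n_plus"
  by (auto simp: queer_unit_def queer_block_n_plus strictly_upper_def matrix_unit_def)

lemma cartan_borel: "cartan \<subseteq> (borel_subalgebra :: 'n::{finite, linorder} queer set)"
  and n_plus_borel: "n_plus \<subseteq> (borel_subalgebra :: 'n queer set)"
proof -
  have "0 \<in> (cartan :: 'n queer set)" "0 \<in> (n_plus :: 'n queer set)"
    by (auto simp: queer_block_cartan queer_block_n_plus queer_ops diagonal_def strictly_upper_def)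
  then show "cartan \<subseteq> (borel_subalgebra :: 'n queer set)" "n_plus \<subseteq> (borel_subalgebra :: 'n queer set)"
    unfolding borel_subalgebra_def by force+
qed


section \<open>The local Weyl module as an instance of the operator setting\<close>

theorem theorem4p10:
  fixes \<psi> :: "('n::{finite, linorder} queer, 'a::complex_comm_algebra_1) tensor \<Rightarrow> complex"
    and \<rho> :: "('n queer, 'a) tensor \<Rightarrow> 'h::super_vector \<Rightarrow> 'h"
  assumes "CARD('n) \<ge> 2"
    and "finitely_generated_algebra TYPE('a)"
    and "\<psi> \<in> loop_weights"
    and "(\<lambda>x. \<psi> (x \<otimes>\<^sub>C 1)) \<in> dominant_weights"
    and "is_H_module \<psi> \<rho>"
  shows "finite_dimensional_module (local_weyl_module \<psi> \<rho>)"
proof -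
  define S where "S = (tensor_span borel_subalgebra UNIV :: ('n queer, 'a) tensor set)"
  define M where "M = induced_module S \<rho>"
  define q where "q t = balancing_relations S \<rho> +>\<^bsub>uea_tensor :: (('n queer, 'a) tensor, _) lie_module\<^esub> t"
    for t :: "(('n queer, 'a) tensor uea, 'h) tensor"
  define G where "G = {induced_tens S \<rho> (uea_embed (f_elem i \<otimes>\<^sub>C 1) ^ (m + 1)) v | i m v.
    i \<in> index_set \<and> of_nat m = \<psi> (h_elem i \<otimes>\<^sub>C 1)}"
  define K where "K = generated_submodule M G"

  interpret B: presented_submodule uea_tensor "\<lambda>t. t" uea_act "balancing_relations S \<rho>"
    by (rule balancing_presented)
  interpret M: presented_module M q uea_act
    unfolding M_def q_def induced_module_def
    by (intro presented_module.intro B.presents_quotient uea_act_linear)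
  have part: "q t \<in> part M i" if "t \<in> part uea_tensor i" for t i
    using that by (simp add: M_def q_def induced_module_def quotient_module_def)
  have "graded_submodule M (carrier M)"
    by (rule M.graded_submodule_carrier) (use uea_tensor_decomp part in blast)
  moreover have "G \<subseteq> carrier M"
    by (auto simp: G_def induced_tens_def M.carrier_eq q_def)
  ultimately interpret K: presented_submodule M q uea_act K
    unfolding K_def by (rule M.presented_generated_submodule)
  define q' where "q' t = K +>\<^bsub>M\<^esub> q t" for t
  interpret W: presented_module "local_weyl_module \<psi> \<rho>" q' uea_act
  proof -
    have "local_weyl_module \<psi> \<rho> = quotient_module M K"
      by (simp add: local_weyl_module_def Let_def M_def K_def G_def S_def)
    then show "presented_module (local_weyl_module \<psi> \<rho>) q' uea_act"
      unfolding q'_def by (intro presented_module.intro) (simp_all add: K.presents_quotient uea_act_linear)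
  qed

  text \<open>The projection \<open>\<pi>\<close> along the kernel \<open>N\<close> of \<open>q'\<close> models the local Weyl module on the range of
    \<open>\<pi>\<close>, turning statements modulo \<open>N\<close> into equations.\<close>
  define N where "N = {t. q t \<in> K}"
  have N: "csubspace N"
    using K.N_zero K.N_add K.N_scale by (auto simp: N_def intro: cvec.subspaceI)
  obtain \<pi> where \<pi>: "clinear \<pi>" "\<And>t. \<pi> t - t \<in> N" "\<And>t. t \<in> N \<Longrightarrow> \<pi> t = 0"
    by (rule exists_projection_along[OF N]) (rule that)
  interpret \<pi>: Vector_Spaces.linear scaleC scaleC \<pi> by (rule \<pi>(1))
  have \<pi>_eqI: "\<pi> s = \<pi> t" if "s - t \<in> N" for s t
    using \<pi>(3)[OF that] by (simp add: \<pi>.diff)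
  \<comment> \<open>\<open>N\<close> is stable under the action, so an inner projection is absorbed
    by the outer one. Hence the operators \<open>X\<close> below satisfy the bracket relations on
    the whole space, not only on the range of \<open>\<pi>\<close>.\<close>
  have \<pi>_act: "\<pi> (uea_act x (\<pi> t)) = \<pi> (uea_act x t)" for x t
  proof (rule \<pi>_eqI)
    interpret A: Vector_Spaces.linear scaleC scaleC "uea_act x" by (rule uea_act_linear)
    show "uea_act x (\<pi> t) - uea_act x t \<in> N"
      using \<pi>(2)[of t] K.N_act by (simp add: N_def flip: A.diff)
  qed

  define X where "X p a i j t = \<pi> (uea_act (queer_unit p i j \<otimes>\<^sub>C a) t)"
    for p and a :: 'a and i j :: 'n and t
  define \<iota> where "\<iota> v = \<pi> (1 \<otimes>\<^sub>C v)" for v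
  have \<iota>: "clinear \<iota>"
    by (simp add: \<iota>_def clinear_iff tens_add_right tens_scaleC_right \<pi>.add \<pi>.scale)
  have \<iota>_zero: "\<iota> 0 = 0" by (simp add: \<iota>_def tens_zero \<pi>.zero)

  note HM = assms(5)[unfolded is_H_module_def]
  have act_\<iota>: "\<pi> (uea_act x (\<iota> v)) = \<iota> (\<rho> x v)" if "x \<in> S" for x v
  proof -
    \<comment> \<open>This difference is the balancing relation for \<open>u = 1\<close> and the
      one-letter word \<open>x\<close>.\<close>
    have "uea_act x (1 \<otimes>\<^sub>C v) - 1 \<otimes>\<^sub>C \<rho> x v = (1 * uea_class (letter x)) \<otimes>\<^sub>C v - 1 \<otimes>\<^sub>C free_action \<rho> (letter x) v"
      by (simp add: uea_act_tens uea_embed_def free_action_def letter_def free_lift_free_vec)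
    also have "\<dots> \<in> balancing_relations S \<rho>"
      unfolding balancing_relations_def
    proof (intro cvec.span_base CollectI exI conjI)
      show "\<forall>w\<in>Poly_Mapping.keys (letter x). set (letters w) \<subseteq> S"
        using that by (simp add: letter_def free_vec_def)
    qed (rule refl)
    finally have "q (uea_act x (1 \<otimes>\<^sub>C v) - 1 \<otimes>\<^sub>C \<rho> x v) = q 0"
      unfolding q_def by (intro B.coset_cong) simp
    then have "uea_act x (1 \<otimes>\<^sub>C v) - 1 \<otimes>\<^sub>C \<rho> x v \<in> N"
      using K.N_zero by (simp add: N_def)
    then show ?thesis by (simp add: \<iota>_def \<pi>_act \<pi>_eqI)
  qed
  have borel: "g \<otimes>\<^sub>C a \<in> S" if "g \<in> borel_subalgebra" for g a
    using that unfolding S_def tensor_span_def by (intro cvec.span_base) blast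
  have cartan_even: "queer_unit 0 i i \<otimes>\<^sub>C a \<in> tensor_span cartan_even T" if "a \<in> T" for i :: 'n and a :: 'a and T
    using that queer_unit_cartan_even unfolding tensor_span_def by (intro cvec.span_base) blast

  obtain I where I: "algebra_ideal I" "finite_codimension I"
    "\<forall>x\<in>tensor_span cartan_even I. \<psi> x = 0" and \<psi>: "linear_on (tensor_span cartan_even UNIV) \<psi>"
    using assms(3) unfolding loop_weights_def by blast

  interpret X: queer_operators X "range \<iota>" "\<lambda>i a. \<psi> (queer_unit 0 i i \<otimes>\<^sub>C a)" I
  proof (rule queer_operators.intro)
    fix p q :: bit and a b :: 'a and i j k l :: 'n and c
      and v :: "(('n queer, 'a) tensor uea, 'h) tensor"
    interpret A: Vector_Spaces.linear scaleC scaleC "\<lambda>x. uea_act x v" by (rule uea_act_linear_left)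
    show "clinear (X p a i j)"
      by (simp add: X_def clinear_iff uea_act_add_right uea_act_scale_right \<pi>.add \<pi>.scale)
    show "X p (a + b) i j v = X p a i j v + X p b i j v"
      by (simp add: X_def tens_add_right A.add \<pi>.add)
    show "X p (c *\<^sub>C a) i j v = c *\<^sub>C X p a i j v"
      by (simp add: X_def tens_scaleC_right A.scale \<pi>.scale)
    have "queer_unit p i j \<otimes>\<^sub>C a \<in> grade p" "queer_unit q k l \<otimes>\<^sub>C b \<in> grade q"
      using queer_unit_grade unfolding grade_tensor_def tensor_span_def by (blast intro: cvec.span_base)+
    note bracket = uea_act_bracket[OF this, of v]
    define D where "D g = \<pi> (uea_act (g \<otimes>\<^sub>C (a * b)) v)" for g :: "'n queer"
    have "clinear D"
      by (simp add: D_def clinear_iff tens_add_left tens_scaleC_left A.add A.scale \<pi>.add \<pi>.scale)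
    then interpret D: Vector_Spaces.linear scaleC scaleC D .
    have "X p a i j (X q b k l v) = koszul p q *\<^sub>C X q b k l (X p a i j v)
        + D ((if j = k then queer_unit (p + q) i l else 0) + (- koszul p q) *\<^sub>C (if l = i then queer_unit (p + q) k j else 0))"
      by (simp only: X_def \<pi>_act bracket lie_bracket_tens queer_unit_bracket \<pi>.add \<pi>.scale D_def)
    also have "\<dots> = koszul p q *\<^sub>C X q b k l (X p a i j v)
        + ((if j = k then D (queer_unit (p + q) i l) else 0) - koszul p q *\<^sub>C (if l = i then D (queer_unit (p + q) k j) else 0))"
      by (simp only: D.add D.diff D.scale D.zero if_distrib[of D] cvec.scale_minus_left add_uminus_conv_diff)
    finally show "X p a i j (X q b k l v) = koszul p q *\<^sub>C X q b k l (X p a i j v)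
      + (if j = k then X (p + q) (a * b) i l v else 0)
      - koszul p q *\<^sub>C (if l = i then X (p + q) (a * b) k j v else 0)"
      unfolding D_def X_def[symmetric] by (simp only: add_diff_eq)
  next
    obtain B0 :: "'h set" where B0: "finite B0" "cspan B0 = UNIV"
      using HM unfolding finite_dimensional_def by blast
    have "\<iota> v \<in> cspan (\<iota> ` B0)" for v
      by (rule clinear_in_subspace[OF \<iota>, of _ B0]) (auto simp: B0 intro: cvec.span_base)
    then show "\<exists>B. finite B \<and> B \<subseteq> range \<iota> \<and> range \<iota> \<subseteq> cspan B"
      using B0(1) by (intro exI[of _ "\<iota> ` B0"]) auto
  next
    fix h and i j :: 'n and p and a :: 'a assume h: "h \<in> range \<iota>" "i < j"
    then obtain v where v: "h = \<iota> v" by blast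
    have "queer_unit p i j \<otimes>\<^sub>C a \<in> tensor_span n_plus UNIV"
      using queer_unit_n_plus[OF h(2)] unfolding tensor_span_def by (intro cvec.span_base) blast
    then have "\<rho> (queer_unit p i j \<otimes>\<^sub>C a) v = 0" using HM by blast
    moreover have "queer_unit p i j \<otimes>\<^sub>C a \<in> S" using queer_unit_n_plus[OF h(2)] n_plus_borel by (intro borel) blast
    ultimately show "X p a i j h = 0" by (simp add: v X_def act_\<iota> \<iota>_zero)
  next
    fix h and i :: 'n and p and a :: 'a assume "h \<in> range \<iota>"
    then obtain v where v: "h = \<iota> v" by blast
    have S: "queer_unit p i i \<otimes>\<^sub>C a \<in> S" for p using queer_unit_cartan cartan_borel by (intro borel) blast
    then show "X p a i i h \<in> range \<iota>" by (simp add: v X_def act_\<iota>)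
    have "\<rho> (queer_unit 0 i i \<otimes>\<^sub>C a) v = \<psi> (queer_unit 0 i i \<otimes>\<^sub>C a) *\<^sub>C v"
      using HM cartan_even[OF UNIV_I] by blast
    then show "X 0 a i i h = \<psi> (queer_unit 0 i i \<otimes>\<^sub>C a) *\<^sub>C h"
      using S[of 0] \<iota> by (simp add: v X_def act_\<iota> clinear_iff)
  next
    fix i :: 'n assume i: "i \<in> index_set"
    let ?\<mu> = "\<lambda>i. \<psi> (queer_unit 0 i i \<otimes>\<^sub>C 1)"
    have k: "k_elem i = queer_unit 0 i i" for i :: 'n by (simp add: k_elem_def queer_unit_def)
    have "?\<mu> i - ?\<mu> (next_index i) \<in> \<nat>"
      using assms(4) i by (simp add: dominant_weights_def k)
    then obtain m where m: "?\<mu> i - ?\<mu> (next_index i) = of_nat m" by (auto elim: Nats_cases)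
    let ?s = "queer_unit 0 (next_index i) (next_index i) \<otimes>\<^sub>C (1 :: 'a)"
    interpret L: Vector_Spaces.linear scaleC scaleC "\<lambda>g :: 'n queer. g \<otimes>\<^sub>C (1 :: 'a)"
      by (rule clinear_tens)
    \<comment> \<open>\<open>linear_on\<close> speaks of sums and multiples inside the Cartan part
      only, so the difference is written as a sum and both terms are placed in that part.\<close>
    have "h_elem i \<otimes>\<^sub>C 1 = queer_unit 0 i i \<otimes>\<^sub>C 1 + (-1) *\<^sub>C ?s"
      by (simp add: h_elem_def k L.diff scaleC_one cvec.scale_minus_left)
    moreover have "(-1) *\<^sub>C ?s \<in> tensor_span cartan_even UNIV"
      using cartan_even[OF UNIV_I, of "next_index i" 1] unfolding tensor_span_def by (rule cvec.span_scale)
    ultimately have "\<psi> (h_elem i \<otimes>\<^sub>C 1) = ?\<mu> i + (-1) * \<psi> ?s"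
      using \<psi> cartan_even[OF UNIV_I] unfolding linear_on_def by metis
    then have m: "of_nat m = \<psi> (h_elem i \<otimes>\<^sub>C 1)" using m by simp
    let ?f = "f_elem i \<otimes>\<^sub>C (1 :: 'a)"
    have f: "f_elem i = queer_unit 0 (next_index i) i" by (simp add: f_elem_def queer_unit_def)
    have pow: "(X 0 1 (next_index i) i ^^ k) (\<pi> t) = \<pi> ((uea_act ?f ^^ k) t)" for k t
      by (induction k) (simp_all add: X_def f \<pi>_act)
    have "(X 0 1 (next_index i) i ^^ (m + 1)) h = 0" if "h \<in> range \<iota>" for h
    proof -
      obtain v where v: "h = \<iota> v" using \<open>h \<in> range \<iota>\<close> by blast
      have "induced_tens S \<rho> (uea_embed ?f ^ (m + 1)) v \<in> G" using i m unfolding G_def by blast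
      then have "q ((uea_embed ?f ^ (m + 1)) \<otimes>\<^sub>C v) \<in> K"
        unfolding K_def generated_submodule_def by (auto simp: q_def induced_tens_def)
      then have "\<pi> ((uea_embed ?f ^ (m + 1)) \<otimes>\<^sub>C v) = 0" by (intro \<pi>(3)) (simp add: N_def)
      then show ?thesis unfolding v \<iota>_def pow uea_act_power by simp
    qed
    then show "\<exists>m. \<forall>h\<in>range \<iota>. (X 0 1 (next_index i) i ^^ m) h = 0" by blast
  next
    show "\<psi> (queer_unit 0 i i \<otimes>\<^sub>C a) = 0" if "a \<in> I" for i a using I(3) cartan_even[OF that] by blast
  qed (use I assms(2) in auto)

  obtain V C where V: "finite C" "V \<subseteq> cspan C" "csubspace V" "range \<iota> \<subseteq> V"
    "\<And>p a i j v. v \<in> V \<Longrightarrow> X p a i j v \<in> V"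
    by (rule X.finite_stable_subspace) (rule that)
  have V_act: "\<pi> (uea_act x w) \<in> V" if w: "w \<in> V" for x w
  proof (induction x rule: tensor_induct)
    case (tens g a)
    show ?case
    proof (rule clinear_in_subspace[where f = "\<lambda>g. \<pi> (uea_act (g \<otimes>\<^sub>C a) w)", OF _ V(3) _ queer_span_units])
      interpret A: Vector_Spaces.linear scaleC scaleC "\<lambda>x. uea_act x w" by (rule uea_act_linear_left)
      show "clinear (\<lambda>g. \<pi> (uea_act (g \<otimes>\<^sub>C a) w))"
        by (simp add: clinear_iff tens_add_left tens_scaleC_left A.add A.scale \<pi>.add \<pi>.scale)
      show "\<pi> (uea_act (g \<otimes>\<^sub>C a) w) \<in> V" if "g \<in> range (\<lambda>(p, i, j). queer_unit p i j)" for g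
        using that V(5)[OF w] by (auto simp: X_def)
    qed
  next
    case (add s t)
    interpret A: Vector_Spaces.linear scaleC scaleC "\<lambda>x. uea_act x w" by (rule uea_act_linear_left)
    show ?case using add V(3) by (simp add: A.add \<pi>.add cvec.subspace_add)
  qed
  \<comment> \<open>\<open>V\<close> is stable under all of q \<otimes> A, so words in arbitrary
    letters are covered without reordering them.\<close>
  have word: "\<pi> (uea_class (free_vec (Word xs)) \<otimes>\<^sub>C v) \<in> V" for xs v
  proof (induction xs)
    case Nil
    then show ?case using V(4) by (auto simp: uea_class_Nil \<iota>_def)
  next
    case (Cons x xs)
    show ?case
      using V_act[OF Cons, of x] by (simp add: \<pi>_act uea_act_tens uea_class_Cons)
  qed
  have "\<pi> t \<in> V" for t
  proof (induction t rule: tensor_induct)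
    case (tens u v)
    show ?case
      by (rule clinear_in_subspace[where f = "\<lambda>u. \<pi> (u \<otimes>\<^sub>C v)", OF _ V(3) _ uea_span_words])
        (use word in \<open>auto simp: clinear_iff tens_add_left tens_scaleC_left \<pi>.add \<pi>.scale\<close>)
  next
    case (add s t)
    then show ?case using V(3) by (simp add: \<pi>.add cvec.subspace_add)
  qed
  moreover have "q' t = q' (\<pi> t)" for t
    using \<pi>(2)[of t] unfolding q'_def by (intro K.coset_cong[symmetric]) (simp add: N_def)
  ultimately show ?thesis
    using V(2) by (intro W.finite_dimensionalI[OF V(1)]) blast
qed

end
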